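(* Let $(X,\sigma)$ be a shift and suppose there exists $k\in\mathbb{N}$ such that $$\limsup_{n\to\infty}\frac{P_X(n)}{n}<k.$$ If $X$ has a dense set of aperiodic points, then $\mathrm{Aut}(X)\cap[\sigma]\cong\mathbb{Z}^d$ for some integer $0\le d<k$, and the quotient group $\mathrm{Aut}(X)/(\mathrm{Aut}(X)\cap[\sigma])$ is finite. In particular, $\mathrm{Aut}(X)$ is virtually $\mathbb{Z}^d$.
   Context: Let $\mathcal{A}$ be a finite alphabet with the discrete topology, give $\mathcal{A}^{\mathbb{Z}}$ the product topology, and let $\sigma\colon\mathcal{A}^{\mathbb{Z}}\to\mathcal{A}^{\mathbb{Z}}$ be the left shift $(\sigma x)(n)=x(n+1)$. A shift $(X,\sigma)$ is a closed set $X\subseteq\mathcal{A}^{\mathbb{Z}}$ with $\sigma(X)=X$. The orbit of $x\in X$ is $\mathcal{O}(x)=\{\sigma^n x: n\in\mathbb{Z}\}$. A point $x$ is periodic if $\sigma^n x=x$ for some $n\ge 1$, and aperiodic otherwise. $\mathrm{Aut}(X)$ is the group of homeomorphisms of $X$ to itself that commute with $\sigma$. The full group $[\sigma]$ is the group of homeomorphisms $\psi$ of $X$ to itself with $\psi(x)\in\mathcal{O}(x)$ for all $x\in X$. The subgroup $\mathrm{Aut}(X)\cap[\sigma]$ is normal in $\mathrm{Aut}(X)$. The complexity function $P_X(n)$ is the number of words $w=(a_0,\dots,a_{n-1})\in\mathcal{A}^n$ for which there is $x\in X$ with $x(i)=a_i$ for all $0\le i<n$. A group $G$ is virtually $H$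 if it contains a subgroup of finite index isomorphic to $H$. *)

theory Defs
  imports "HOL-Analysis.Analysis" "HOL-Algebra.Bij" "HOL-Algebra.Product_Groups"
begin

section \<open>Shifts over a finite alphabet\<close>

definition full_shift :: "'a set \<Rightarrow> (int \<Rightarrow> 'a) topology" where
  "full_shift A = product_topology (\<lambda>_. discrete_topology A) UNIV"

definition shift_map :: "(int \<Rightarrow> 'a) \<Rightarrow> int \<Rightarrow> 'a" where
  "shift_map x = (\<lambda>n. x (n + 1))"

definition shift_power :: "int \<Rightarrow> (int \<Rightarrow> 'a) \<Rightarrow> int \<Rightarrow> 'a" where
  "shift_power n = (if n \<ge> 0 then shift_map ^^ nat n else (inv_into UNIV shift_map) ^^ nat (- n))"

definition is_shift :: "'a set \<Rightarrow> (int \<Rightarrow> 'a) set \<Rightarrow> bool" where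
  "is_shift A X \<longleftrightarrow> closedin (full_shift A) X \<and> shift_map ` X = X"

definition shift_orbit :: "(int \<Rightarrow> 'a) \<Rightarrow> (int \<Rightarrow> 'a) set" where
  "shift_orbit x = range (\<lambda>n. shift_power n x)"

definition periodic :: "(int \<Rightarrow> 'a) \<Rightarrow> bool" where
  "periodic x \<longleftrightarrow> (\<exists>n::nat. n \<ge> 1 \<and> (shift_map ^^ n) x = x)"

definition complexity :: "'a set \<Rightarrow> (int \<Rightarrow> 'a) set \<Rightarrow> nat \<Rightarrow> nat" where
  "complexity A X n =
     card {w. length w = n \<and> set w \<subseteq> A \<and> (\<exists>x\<in>X. \<forall>i<n. x (int i) = w ! i)}"

definition shift_topology :: "'a set \<Rightarrow> (int \<Rightarrow> 'a) set \<Rightarrow> (int \<Rightarrow> 'a) topology" where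
  "shift_topology A X = subtopology (full_shift A) X"

section \<open>Automorphisms and the full group\<close>

text \<open>As in \<^const>\<open>Bij\<close>, self-maps of a space are taken to be extensional (\<^const>\<open>undefined\<close>
  outside the space), so that equal maps of the space are equal elements of the group.\<close>

definition homeo_group :: "'b topology \<Rightarrow> ('b \<Rightarrow> 'b) monoid" where
  "homeo_group T = (BijGroup (topspace T))
     \<lparr>carrier := {f \<in> Bij (topspace T). homeomorphic_map T T f}\<rparr>"

definition Aut :: "'a set \<Rightarrow> (int \<Rightarrow> 'a) set \<Rightarrow> ((int \<Rightarrow> 'a) \<Rightarrow> int \<Rightarrow> 'a) set" where
  "Aut A X = {\<phi> \<in> carrier (homeo_group (shift_topology A X)).
     \<forall>x\<in>X. \<phi> (shift_map x) = shift_map (\<phi> x)}"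

definition full_group :: "'a set \<Rightarrow> (int \<Rightarrow> 'a) set \<Rightarrow> ((int \<Rightarrow> 'a) \<Rightarrow> int \<Rightarrow> 'a) set" where
  "full_group A X = {\<psi> \<in> carrier (homeo_group (shift_topology A X)).
     \<forall>x\<in>X. \<psi> x \<in> shift_orbit x}"

definition Aut_group :: "'a set \<Rightarrow> (int \<Rightarrow> 'a) set \<Rightarrow> ((int \<Rightarrow> 'a) \<Rightarrow> int \<Rightarrow> 'a) monoid" where
  "Aut_group A X = (homeo_group (shift_topology A X))\<lparr>carrier := Aut A X\<rparr>"

section \<open>Group-theoretic notions\<close>

definition integer_lattice_group :: "nat \<Rightarrow> (nat \<Rightarrow> int) monoid" where
  "integer_lattice_group d = product_group {..<d} (\<lambda>_. integer_group)"

definition virtually :: "('b, 'm) monoid_scheme \<Rightarrow> ('c, 'n) monoid_scheme \<Rightarrow> bool" where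
  "virtually G H \<longleftrightarrow>
     (\<exists>K. subgroup K G \<and> finite (rcosets\<^bsub>G\<^esub> K) \<and> G\<lparr>carrier := K\<rparr> \<cong> H)"

section \<open>Basic facts\<close>

lemma inv_shift_map: "inv_into UNIV shift_map = (\<lambda>(x :: int \<Rightarrow> 'a) n. x (n - 1))"
  by (rule inv_unique_comp) (auto simp: shift_map_def fun_eq_iff)

lemma shift_map_funpow: "(shift_map ^^ n) x = (\<lambda>i. x (i + int n))"
  by (induction n) (auto simp: shift_map_def fun_eq_iff algebra_simps)

lemma inv_shift_map_funpow: "((inv_into UNIV shift_map) ^^ n) x = (\<lambda>i. x (i - int n))"
  by (induction n) (auto simp: inv_shift_map fun_eq_iff algebra_simps)

lemma shift_power_apply: "shift_power n x i = x (i + n)"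
  by (simp add: shift_power_def shift_map_funpow inv_shift_map_funpow)

lemma topspace_shift_topology: "is_shift A X \<Longrightarrow> topspace (shift_topology A X) = X"
  using closedin_subset by (fastforce simp: is_shift_def shift_topology_def)

lemma homeomorphic_map_inv_into:
  assumes "homeomorphic_map T T f"
  shows "homeomorphic_map T T (inv_into (topspace T) f)"
proof -
  obtain g where g: "homeomorphic_maps T T f g"
    using assms by (auto simp: homeomorphic_map_maps)
  have inj: "inj_on f (topspace T)"
    using assms by (simp add: homeomorphic_map_def)
  have "inv_into (topspace T) f y = g y" if "y \<in> topspace T" for y
    using g that inj
    by (intro inv_into_f_eq) (auto simp: homeomorphic_maps_def continuous_map_def Pi_iff)
  moreover have "homeomorphic_map T T g"
    using g homeomorphic_maps_map by blast
  ultimately show ?thesis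
    by (metis homeomorphic_map_eq)
qed

lemma homeo_subgroup:
  "subgroup {f \<in> Bij (topspace T). homeomorphic_map T T f} (BijGroup (topspace T))"
proof (rule group.subgroupI[OF group_BijGroup])
  show "{f \<in> Bij (topspace T). homeomorphic_map T T f} \<noteq> {}"
    using id_Bij[of "topspace T"] homeomorphic_map_eq[of T T id "\<lambda>x\<in>topspace T. x"] by auto
next
  fix f assume f: "f \<in> {f \<in> Bij (topspace T). homeomorphic_map T T f}"
  then have "homeomorphic_map T T (\<lambda>x\<in>topspace T. inv_into (topspace T) f x)"
    using homeomorphic_map_eq[OF homeomorphic_map_inv_into[of T f]] by auto
  with f show "inv\<^bsub>BijGroup (topspace T)\<^esub> f \<in> {f \<in> Bij (topspace T). homeomorphic_map T T f}"
    by (auto simp: inv_BijGroup restrict_inv_into_Bij)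
next
  fix f g assume fg: "f \<in> {f \<in> Bij (topspace T). homeomorphic_map T T f}"
    "g \<in> {f \<in> Bij (topspace T). homeomorphic_map T T f}"
  then have "homeomorphic_map T T (compose (topspace T) f g)"
    using homeomorphic_map_eq[OF homeomorphic_map_compose[of T T g T f]]
    by (auto simp: compose_def)
  with fg show "f \<otimes>\<^bsub>BijGroup (topspace T)\<^esub> g \<in> {f \<in> Bij (topspace T). homeomorphic_map T T f}"
    by (auto simp: BijGroup_def compose_Bij)
qed (auto simp: BijGroup_def)

lemma group_homeo_group: "group (homeo_group T)"
  unfolding homeo_group_def
  by (rule subgroup.subgroup_is_group[OF homeo_subgroup group_BijGroup])

lemma homeo_group_simps:
  "carrier (homeo_group T) = {f \<in> Bij (topspace T). homeomorphic_map T T f}"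
  "one (homeo_group T) = (\<lambda>x\<in>topspace T. x)"
  "f \<in> carrier (homeo_group T) \<Longrightarrow> g \<in> carrier (homeo_group T) \<Longrightarrow>
     f \<otimes>\<^bsub>homeo_group T\<^esub> g = compose (topspace T) f g"
  by (auto simp: homeo_group_def BijGroup_def)

lemma homeo_group_apply_mem:
  assumes "f \<in> carrier (homeo_group T)" "x \<in> topspace T"
  shows "f x \<in> topspace T"
  using assms by (auto simp: homeo_group_simps dest: Bij_imp_funcset)

lemma homeo_group_inv:
  assumes f: "f \<in> carrier (homeo_group T)" and x: "x \<in> topspace T"
  shows "f ((inv\<^bsub>homeo_group T\<^esub> f) x) = x" "(inv\<^bsub>homeo_group T\<^esub> f) (f x) = x"
proof -
  interpret group "homeo_group T" by (rule group_homeo_group)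
  have "(f \<otimes>\<^bsub>homeo_group T\<^esub> inv\<^bsub>homeo_group T\<^esub> f) x = x"
    "(inv\<^bsub>homeo_group T\<^esub> f \<otimes>\<^bsub>homeo_group T\<^esub> f) x = x"
    using f x by (simp_all add: r_inv l_inv homeo_group_simps(2))
  with f x show "f ((inv\<^bsub>homeo_group T\<^esub> f) x) = x" "(inv\<^bsub>homeo_group T\<^esub> f) (f x) = x"
    using inv_closed[OF f] by (simp_all add: homeo_group_simps(3) compose_def)
qed

lemma subgroup_Aut:
  assumes "is_shift A X"
  shows "subgroup (Aut A X) (homeo_group (shift_topology A X))"
proof -
  let ?H = "homeo_group (shift_topology A X)"
  interpret group ?H by (rule group_homeo_group)
  note X = topspace_shift_topology[OF assms]
  have S: "shift_map x \<in> X" if "x \<in> X" for x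
    using assms that by (auto simp: is_shift_def)
  show ?thesis
  proof (rule subgroupI)
    have "\<one>\<^bsub>?H\<^esub> \<in> Aut A X"
      using S one_closed by (auto simp: Aut_def homeo_group_simps(2) X)
    then show "Aut A X \<noteq> {}" by auto
  next
    fix f assume f: "f \<in> Aut A X"
    then have fH: "f \<in> carrier ?H" by (simp add: Aut_def)
    have "(inv\<^bsub>?H\<^esub> f) (shift_map x) = shift_map ((inv\<^bsub>?H\<^esub> f) x)" if x: "x \<in> X" for x
    proof -
      let ?y = "(inv\<^bsub>?H\<^esub> f) x"
      have y: "?y \<in> X"
        using homeo_group_apply_mem[OF inv_closed[OF fH]] x X by auto
      have "f (shift_map ?y) = shift_map x"
        using f y x homeo_group_inv(1)[OF fH] X by (auto simp: Aut_def)
      then show ?thesis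
        using homeo_group_inv(2)[OF fH, of "shift_map ?y"] S[OF y] X by metis
    qed
    with fH show "inv\<^bsub>?H\<^esub> f \<in> Aut A X" by (simp add: Aut_def)
  next
    fix f g assume f: "f \<in> Aut A X" and g: "g \<in> Aut A X"
    then have H: "f \<in> carrier ?H" "g \<in> carrier ?H" by (simp_all add: Aut_def)
    have "g x \<in> X" if "x \<in> X" for x
      using homeo_group_apply_mem[OF H(2)] that X by auto
    then show "f \<otimes>\<^bsub>?H\<^esub> g \<in> Aut A X"
      using f g m_closed[OF H] S by (auto simp: Aut_def homeo_group_simps(3) X compose_def)
  qed (auto simp: Aut_def)
qed

lemma group_Aut_group: "is_shift A X \<Longrightarrow> group (Aut_group A X)"
  unfolding Aut_group_def
  by (rule subgroup.subgroup_is_group[OF subgroup_Aut group_homeo_group])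

lemma shift_orbit_refl: "x \<in> shift_orbit x"
proof -
  have "x = shift_power 0 x" by (simp add: shift_power_apply fun_eq_iff)
  then show ?thesis unfolding shift_orbit_def by (rule range_eqI)
qed

lemma shift_orbit_sym:
  assumes "y \<in> shift_orbit x"
  shows "x \<in> shift_orbit y"
proof -
  obtain n where "y = shift_power n x" using assms by (auto simp: shift_orbit_def)
  then have "x = shift_power (- n) y" by (simp add: shift_power_apply fun_eq_iff)
  then show ?thesis unfolding shift_orbit_def by (rule range_eqI)
qed

lemma shift_orbit_trans:
  assumes "y \<in> shift_orbit x" "z \<in> shift_orbit y"
  shows "z \<in> shift_orbit x"
proof -
  obtain m n where "y = shift_power n x" "z = shift_power m y"
    using assms by (auto simp: shift_orbit_def)
  then have "z = shift_power (m + n) x"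
    by (simp add: shift_power_apply fun_eq_iff algebra_simps)
  then show ?thesis unfolding shift_orbit_def by (rule range_eqI)
qed

lemma subgroup_full_group:
  assumes "is_shift A X"
  shows "subgroup (full_group A X) (homeo_group (shift_topology A X))"
proof -
  let ?H = "homeo_group (shift_topology A X)"
  interpret group ?H by (rule group_homeo_group)
  note X = topspace_shift_topology[OF assms]
  show ?thesis
  proof (rule subgroupI)
    have "\<one>\<^bsub>?H\<^esub> \<in> full_group A X"
      using one_closed by (auto simp: full_group_def homeo_group_simps(2) X shift_orbit_refl)
    then show "full_group A X \<noteq> {}" by auto
  next
    fix f assume f: "f \<in> full_group A X"
    then have fH: "f \<in> carrier ?H" by (simp add: full_group_def)
    have "(inv\<^bsub>?H\<^esub> f) x \<in> shift_orbit x" if x: "x \<in> X" for x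
    proof -
      let ?y = "(inv\<^bsub>?H\<^esub> f) x"
      have "?y \<in> X"
        using homeo_group_apply_mem[OF inv_closed[OF fH]] x X by auto
      then have "f ?y \<in> shift_orbit ?y" using f by (simp add: full_group_def)
      then show ?thesis
        using homeo_group_inv(1)[OF fH] x X shift_orbit_sym by metis
    qed
    with fH show "inv\<^bsub>?H\<^esub> f \<in> full_group A X" by (simp add: full_group_def)
  next
    fix f g assume f: "f \<in> full_group A X" and g: "g \<in> full_group A X"
    then have H: "f \<in> carrier ?H" "g \<in> carrier ?H" by (simp_all add: full_group_def)
    have "g x \<in> X" if "x \<in> X" for x
      using homeo_group_apply_mem[OF H(2)] that X by auto
    then have "(f \<otimes>\<^bsub>?H\<^esub> g) x \<in> shift_orbit x" if "x \<in> X" for x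
      using f g H that
      by (auto simp: full_group_def homeo_group_simps(3) X compose_def intro: shift_orbit_trans)
    then show "f \<otimes>\<^bsub>?H\<^esub> g \<in> full_group A X"
      using m_closed[OF H] by (simp add: full_group_def)
  qed (auto simp: full_group_def)
qed

lemma Aut_funpow:
  assumes X: "is_shift A X" and f: "f \<in> Aut A X" and x: "x \<in> X"
  shows "(shift_map ^^ n) x \<in> X \<and> f ((shift_map ^^ n) x) = (shift_map ^^ n) (f x)"
proof (induction n)
  case (Suc n)
  then show ?case using X f by (auto simp: is_shift_def Aut_def)
qed (simp add: x)

lemma Aut_shift_orbit:
  assumes X: "is_shift A X" and f: "f \<in> Aut A X" and x: "x \<in> X" "y \<in> X"
    and y: "y \<in> shift_orbit x"
  shows "f y \<in> shift_orbit (f x)"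
proof -
  have forward: "f ((shift_map ^^ n) z) \<in> shift_orbit (f z)" if "z \<in> X" for n z
  proof -
    have "(shift_map ^^ n) (f z) = shift_power (int n) (f z)"
      by (simp add: shift_power_def)
    then show ?thesis
      using Aut_funpow[OF X f that] by (auto simp: shift_orbit_def)
  qed
  obtain m where m: "y = shift_power m x" using y by (auto simp: shift_orbit_def)
  show ?thesis
  proof (cases "m \<ge> 0")
    case True
    with m forward[OF x(1)] show ?thesis by (simp add: shift_power_def)
  next
    case False
    with m have "x = (shift_map ^^ nat (- m)) y"
      by (simp add: shift_map_funpow shift_power_apply fun_eq_iff)
    then show ?thesis using forward[OF x(2)] shift_orbit_sym by metis
  qed
qed

lemma normal_Aut_Int_full_group:
  assumes X: "is_shift A X"
  shows "(Aut A X \<inter> full_group A X) \<lhd> Aut_group A X"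
proof -
  let ?H = "homeo_group (shift_topology A X)" and ?N = "Aut A X \<inter> full_group A X"
  interpret H: group ?H by (rule group_homeo_group)
  interpret G: group "Aut_group A X" by (rule group_Aut_group[OF X])
  note T = topspace_shift_topology[OF X]
  have sub: "subgroup ?N (Aut_group A X)"
    unfolding Aut_group_def
    by (intro H.subgroup_incl H.subgroups_Inter_pair subgroup_Aut subgroup_full_group X) auto
  have "g \<otimes>\<^bsub>Aut_group A X\<^esub> h \<otimes>\<^bsub>Aut_group A X\<^esub> inv\<^bsub>Aut_group A X\<^esub> g \<in> ?N"
    if "g \<in> carrier (Aut_group A X)" and h: "h \<in> ?N" for g h
  proof -
    have g: "g \<in> Aut A X" using that(1) by (simp add: Aut_group_def)
    have inv: "inv\<^bsub>Aut_group A X\<^esub> g = inv\<^bsub>?H\<^esub> g"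
      unfolding Aut_group_def using H.m_inv_consistent[OF subgroup_Aut[OF X] g] by simp
    have mem: "g \<in> carrier ?H" "h \<in> carrier ?H" using g h by (auto simp: Aut_def)
    let ?c = "g \<otimes>\<^bsub>?H\<^esub> h \<otimes>\<^bsub>?H\<^esub> inv\<^bsub>?H\<^esub> g"
    have cA: "?c \<in> Aut A X"
      using g h subgroup_Aut[OF X] by (auto intro: subgroup.m_closed subgroup.m_inv_closed)
    moreover have "?c x \<in> shift_orbit x" if x: "x \<in> X" for x
    proof -
      let ?y = "(inv\<^bsub>?H\<^esub> g) x"
      have y: "?y \<in> X" and hy: "h ?y \<in> X"
        using homeo_group_apply_mem x T mem H.inv_closed[OF mem(1)] by metis+
      have "h ?y \<in> shift_orbit ?y" using h y by (auto simp: full_group_def)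
      from Aut_shift_orbit[OF X g y hy this] have "g (h ?y) \<in> shift_orbit x"
        using homeo_group_inv(1)[OF mem(1)] x T by metis
      moreover have "?c x = g (h ?y)"
        using homeo_group_simps(3)[OF H.m_closed[OF mem] H.inv_closed[OF mem(1)]]
          homeo_group_simps(3)[OF mem] x y by (simp add: compose_def T)
      ultimately show ?thesis by simp
    qed
    ultimately have "?c \<in> ?N"
      by (auto simp: full_group_def Aut_def)
    then show ?thesis unfolding inv by (simp add: Aut_group_def)
  qed
  with sub show ?thesis by (auto simp: G.normal_inv_iff)
qed

end

(* The maps "shift by a constant on each orbit" embed Aut(X) \<inter> [\<sigma>] into a lattice: an automorphism is
   determined by its values on points whose orbit closures cover X, and by a Morse--Hedlund count
   fewer than k aperiodic points suffice, since each point of a list that is not in the closure of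
   the earlier orbits contributes at least n - C new words of length n.

   For the finiteness of the quotient it is enough to find in each of the finitely many maximal orbit
   closures a point y with dense orbit whose image under Aut(X) meets finitely many orbits. If some
   such y is not forward recurrent, then so are its images, and each of them, after a shift, has
   a last occurrence at 0 of a word depending only on the closure; there are fewer than k points of this kind. Otherwise the
   orbit closure is minimal and contains two distinct points that agree to the right of 0. Their
   images agree to the right of some position, so that a left special right-infinite sequence appears
   there. There are fewer than k of these, and by recurrence it determines the orbit of the image. *)
theory Submission
  imports Defs
begin

subsection \<open>Factors of bi-infinite sequences\<close>

text \<open>Everything rests on finite windows. \<open>x \<preceq> y\<close> expresses through words
  that x lies in the orbit closure of y, and an identity
  \<open>\<phi> y = shift_power d (\<phi>' y)\<close> between sliding block codes is a condition on
  windows, so it passes from y to its whole orbit closure. With the identity map as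
  \<open>\<phi>'\<close>, the shift amounts on a covering list become a faithful invariant; with two
  automorphisms, the orbits of the images of the covering points determine the coset. Periodic
  points are the obstacle: Morse-Hedlund yields no linear growth for them, so the count of aperiodic
  points does not bound them. Density of the aperiodic points does: it forces each periodic orbit to
  contain a special word of every length, and at arbitrarily large lengths there are fewer than 2k
  special words. Hence the points whose orbits are not dense in the closure of an aperiodic x lie in
  finitely many closures that miss x, and one word of x avoids all of them. Its last occurrence pins
  down a point that is not forward recurrent, and long gaps between its occurrences rule out
  recurrence when the closure is not minimal.\<close>

definition factor :: "(int \<Rightarrow> 'a) \<Rightarrow> int \<Rightarrow> nat \<Rightarrow> 'a list" where
  "factor x i n = map (\<lambda>j. x (i + int j)) [0..<n]"

definition factors :: "(int \<Rightarrow> 'a) \<Rightarrow> nat \<Rightarrow> 'a list set" where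
  "factors x n = range (\<lambda>i. factor x i n)"

definition orbit_le :: "(int \<Rightarrow> 'a) \<Rightarrow> (int \<Rightarrow> 'a) \<Rightarrow> bool" (infix "\<preceq>" 50) where
  "x \<preceq> y \<longleftrightarrow> (\<forall>n. factors x n \<subseteq> factors y n)"

lemma factor_eq_iff:
  "factor x i n = factor y j n \<longleftrightarrow> (\<forall>m. 0 \<le> m \<and> m < int n \<longrightarrow> x (i + m) = y (j + m))"
proof
  assume "factor x i n = factor y j n"
  then have *: "\<forall>m<n. x (i + int m) = y (j + int m)"
    by (simp add: factor_def)
  show "\<forall>m. 0 \<le> m \<and> m < int n \<longrightarrow> x (i + m) = y (j + m)"
  proof (intro allI impI)
    fix m assume "0 \<le> m \<and> m < int n"
    then show "x (i + m) = y (j + m)" using *[rule_format, of "nat m"] by (simp add: nat_less_iff)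
  qed
qed (simp add: factor_def)

lemma length_factor [simp]: "length (factor x i n) = n"
  by (simp add: factor_def)

lemma factor_Suc: "factor x i (Suc n) = factor x i n @ [x (i + int n)]"
  by (simp add: factor_def)

lemma factor_Suc': "factor x i (Suc n) = x i # factor x (i + 1) n"
  by (simp add: factor_def upt_rec[of 0] map_Suc_upt[symmetric] algebra_simps del: upt_Suc)

lemma butlast_factor [simp]: "butlast (factor x i (Suc n)) = factor x i n"
  by (simp add: factor_Suc)

lemma tl_factor [simp]: "tl (factor x i (Suc n)) = factor x (i + 1) n"
  by (simp add: factor_Suc')

lemma factor_sub:
  assumes "factor x i n = factor y j n" "0 \<le> a" "a + int m \<le> int n"
  shows "factor x (i + a) m = factor y (j + a) m"
  unfolding factor_eq_iff
proof (intro allI impI)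
  fix b assume "0 \<le> b \<and> b < int m"
  then have "0 \<le> a + b \<and> a + b < int n" using assms by auto
  then show "x (i + a + b) = y (j + a + b)"
    using assms(1) unfolding factor_eq_iff by (metis add.assoc)
qed

lemma factor_shift_power: "factor (shift_power s x) i n = factor x (i + s) n"
  by (simp add: factor_def shift_power_apply algebra_simps)

lemma factor_in_factors [simp]: "factor x i n \<in> factors x n"
  by (simp add: factors_def)

lemma factorsE:
  assumes "w \<in> factors x n" obtains i where "w = factor x i n"
  using assms by (auto simp: factors_def)

lemma orbit_le_refl [simp]: "x \<preceq> x"
  by (simp add: orbit_le_def)

lemma orbit_le_trans: "x \<preceq> y \<Longrightarrow> y \<preceq> z \<Longrightarrow> x \<preceq> z"
  by (auto simp: orbit_le_def)

lemma orbit_leD: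
  assumes "x \<preceq> y" obtains j where "factor x i n = factor y j n"
  using assms unfolding orbit_le_def by (metis factor_in_factors factorsE subsetD)

lemma orbit_leI:
  assumes "\<And>i n. \<exists>j. factor x i n = factor y j n" shows "x \<preceq> y"
  using assms by (force simp: orbit_le_def factors_def)

lemma factors_mono:
  assumes "factor x i n \<in> factors y n" "0 \<le> a" "a + int m \<le> int n"
  shows "factor x (i + a) m \<in> factors y m"
  using assms factor_sub by (metis factorsE factor_in_factors)

text \<open>Any word that separates y from x lies inside all large central windows of y. The
  \<open>eventually\<close> form lets finitely many such conditions hold at one common
  length.\<close>

lemma eventually_separated:
  assumes "\<not> y \<preceq> x"
  shows "\<forall>\<^sub>F n in sequentially. factor y (- int n) (2 * n) \<notin> factors x (2 * n)"
proof -
  obtain n w where "w \<in> factors y n" "w \<notin> factors x n"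
    using assms unfolding orbit_le_def by blast
  then obtain i where ni: "factor y i n \<notin> factors x n" by (metis factorsE)
  have "factor y (- int m) (2 * m) \<notin> factors x (2 * m)" if "m \<ge> nat (\<bar>i\<bar> + int n)" for m
  proof
    assume "factor y (- int m) (2 * m) \<in> factors x (2 * m)"
    moreover have "0 \<le> int m + i \<and> int m + i + int n \<le> int (2 * m)" using that by linarith
    ultimately show False using factors_mono[of y "- int m" "2 * m" x "int m + i" n] ni by simp
  qed
  then show ?thesis unfolding eventually_sequentially by blast
qed

lemma eventually_distinct_factor:
  assumes "y \<noteq> x"
  shows "\<forall>\<^sub>F n in sequentially. factor y (- int n) (2 * n) \<noteq> factor x (- int n) (2 * n)"
proof -
  obtain i where i: "y i \<noteq> x i" using assms by auto
  have "factor y (- int m) (2 * m) \<noteq> factor x (- int m) (2 * m)" if "m \<ge> nat (\<bar>i\<bar> + 1)" for m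
  proof
    assume "factor y (- int m) (2 * m) = factor x (- int m) (2 * m)"
    from factor_sub[OF this, of "int m + i" 1] that have "factor y i 1 = factor x i 1" by simp
    with i show False by (simp add: factor_def)
  qed
  then show ?thesis unfolding eventually_sequentially by blast
qed

section \<open>Periodicity seen through words\<close>

lemma periodic_iff: "periodic x \<longleftrightarrow> (\<exists>p>0. \<forall>i. x (i + int p) = x i)"
  by (auto simp: periodic_def shift_map_funpow fun_eq_iff Suc_le_eq)

lemma periodic_shift_power: "periodic (shift_power s x) \<longleftrightarrow> periodic x"
proof -
  have *: "periodic (shift_power s x)" if per: "periodic x" for x :: "int \<Rightarrow> 'a" and s
  proof -
    obtain p where p: "p > 0" "\<And>i. x (i + int p) = x i" using per by (auto simp: periodic_iff)
    have "x (i + int p + s) = x (i + s)" for i using p(2)[of "i + s"] by (simp add: algebra_simps)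
    with p(1) show ?thesis by (auto simp: periodic_iff shift_power_apply)
  qed
  have "x = shift_power (- s) (shift_power s x)" by (simp add: shift_power_apply fun_eq_iff)
  then show ?thesis using * by metis
qed

lemma periodic_orbit_le:
  assumes "x \<preceq> p" "periodic p" shows "periodic x"
proof -
  obtain q where q: "q > 0" "\<And>i. p (i + int q) = p i" using assms by (auto simp: periodic_iff)
  have "x (i + int q) = x i" for i
  proof -
    \<comment> \<open>Length q + 1 is just enough to contain two letters at distance q.\<close>
    obtain j where "factor x i (Suc q) = factor p j (Suc q)" using assms(1) by (rule orbit_leD)
    then have "x (i + 0) = p (j + 0)" "x (i + int q) = p (j + int q)"
      unfolding factor_eq_iff by (auto simp del: add_0_right)
    then show ?thesis using q by simp
  qed
  with q show ?thesis by (auto simp: periodic_iff)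
qed

lemma int_induct_both:
  fixes P :: "int \<Rightarrow> bool"
  assumes "P i0" "\<And>i. P i \<Longrightarrow> P (i + 1)" "\<And>i. P i \<Longrightarrow> P (i - 1)"
  shows "P i"
  using assms by (induction i rule: int_induct[of _ i0]) auto

lemma shift_power_eq_periodic:
  assumes "shift_power s x = shift_power t x" "s \<noteq> t" shows "periodic x"
proof -
  have *: "periodic x" if "shift_power s x = shift_power t x" "s < t" for s t
  proof -
    have "x (i + int (nat (t - s))) = x i" for i
      using that(2) fun_cong[OF that(1), of "i - s"] by (simp add: shift_power_apply algebra_simps)
    then show ?thesis using that(2) unfolding periodic_iff by (intro exI[of _ "nat (t - s)"]) auto
  qed
  show ?thesis using *[of s t] *[of t s] assms by (metis linorder_neqE)
qed

section \<open>Morse-Hedlund arguments\<close>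

lemma butlast_factors: "butlast ` factors x (Suc n) = factors x n"
  by (simp add: factors_def image_image)

lemma tl_factors: "tl ` factors x (Suc n) = factors x n"
proof -
  have "tl ` factors x (Suc n) = range (\<lambda>i. factor x (i + 1) n)"
    by (simp add: factors_def image_image)
  also have "\<dots> = factors x n"
  proof -
    have "factor x i n = factor x (i - 1 + 1) n" for i by simp
    then show ?thesis unfolding factors_def by blast
  qed
  finally show ?thesis .
qed

text \<open>A Morse--Hedlund type argument: without branching to the right, finiteness also rules out
  branching to the left, so each factor determines the whole sequence around it.\<close>

lemma inj_butlast_periodic:
  assumes fin: "finite (factors x n)" and inj: "inj_on butlast (factors x (Suc n))"
  shows "periodic x"
proof -
  have b: "butlast ` factors x (Suc n) = factors x n" by (rule butlast_factors)
  have t: "tl ` factors x (Suc n) = factors x n" by (rule tl_factors)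
  have fin': "finite (factors x (Suc n))" using fin b inj finite_imageD by metis
  have "card (factors x (Suc n)) = card (factors x n)" using card_image[OF inj] b by simp
  then have inj': "inj_on tl (factors x (Suc n))"
    using fin' t by (simp add: eq_card_imp_inj_on)
  \<comment> \<open>Pigeonhole: two of the infinitely many positions carry the same word, and unique
    extension on both sides spreads this coincidence over the whole sequence.\<close>
  have "\<not> inj_on (\<lambda>i. factor x i n) (UNIV :: int set)"
    using fin finite_imageD infinite_UNIV_int unfolding factors_def by blast
  then obtain i j where ij: "i \<noteq> j" "factor x i n = factor x j n" by (auto simp: inj_on_def)
  have eq: "factor x (i + t) n = factor x (j + t) n" for t
  proof (induction t rule: int_induct_both[of _ 0])
    case (2 t)
    then have "butlast (factor x (i + t) (Suc n)) = butlast (factor x (j + t) (Suc n))" by simp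
    then have "factor x (i + t) (Suc n) = factor x (j + t) (Suc n)"
      by (rule inj_onD[OF inj]) simp_all
    then have "tl (factor x (i + t) (Suc n)) = tl (factor x (j + t) (Suc n))" by simp
    then show ?case by (simp add: algebra_simps)
  next
    case (3 t)
    then have "tl (factor x (i + t - 1) (Suc n)) = tl (factor x (j + t - 1) (Suc n))" by simp
    then have "factor x (i + t - 1) (Suc n) = factor x (j + t - 1) (Suc n)"
      by (rule inj_onD[OF inj']) simp_all
    then have "butlast (factor x (i + t - 1) (Suc n)) = butlast (factor x (j + t - 1) (Suc n))" by simp
    then show ?case by (simp add: algebra_simps)
  qed (use ij in simp)
  have "x (i + t) = x (j + t)" for t
  proof -
    have "butlast (factor x (i + t) (Suc n)) = butlast (factor x (j + t) (Suc n))"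
      using eq[of t] by simp
    then have "factor x (i + t) (Suc n) = factor x (j + t) (Suc n)"
      by (rule inj_onD[OF inj]) simp_all
    then show ?thesis by (simp add: factor_Suc')
  qed
  then have "shift_power i x = shift_power j x"
    by (simp add: shift_power_apply fun_eq_iff add.commute)
  then show ?thesis using ij shift_power_eq_periodic by blast
qed

text \<open>Injectivity of \<open>tl\<close> makes the words of lengths n and n + 1 equally many, so
  \<open>butlast\<close>, which is also onto, is injective too.\<close>

lemma inj_tl_periodic:
  assumes fin: "finite (factors x n)" and inj: "inj_on tl (factors x (Suc n))"
  shows "periodic x"
proof -
  have "finite (factors x (Suc n))" using fin tl_factors inj finite_imageD by metis
  moreover have "card (factors x (Suc n)) = card (butlast ` factors x (Suc n))"
    using card_image[OF inj] by (simp add: tl_factors butlast_factors)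
  ultimately have "inj_on butlast (factors x (Suc n))" by (simp add: eq_card_imp_inj_on)
  then show ?thesis using fin inj_butlast_periodic by blast
qed

text \<open>Counting only words that contain u keeps them apart from the words of every sequence in
  which u does not occur.\<close>

definition factors_with :: "(int \<Rightarrow> 'a) \<Rightarrow> 'a list \<Rightarrow> nat \<Rightarrow> 'a list set" where
  "factors_with x u n = {factor x i n | i a.
     0 \<le> a \<and> a + int (length u) \<le> int n \<and> factor x (i + a) (length u) = u}"

lemma factors_with_subset: "factors_with x u n \<subseteq> factors x n"
  by (auto simp: factors_with_def)

lemma factors_withI:
  assumes "0 \<le> a" "a + int (length u) \<le> int n" "factor x (i + a) (length u) = u"
  shows "factor x i n \<in> factors_with x u n"
  unfolding factors_with_def using assms by blast

lemma factors_withE: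
  assumes "factor x i n \<in> factors_with x u n"
  obtains a where "0 \<le> a" "a + int (length u) \<le> int n" "factor x (i + a) (length u) = u"
proof -
  from assms obtain j a where a: "factor x i n = factor x j n" "0 \<le> a"
    "a + int (length u) \<le> int n" "factor x (j + a) (length u) = u"
    unfolding factors_with_def by blast
  then have "factor x (i + a) (length u) = u" using factor_sub[OF a(1-3)] by simp
  with a show ?thesis using that by blast
qed

text \<open>Morse-Hedlund relative to u: an occurrence of u survives adding a letter on either side,
  so the count never drops, and a standstill forces periodicity. It starts at 1, from u itself, when
  n is the length of u.\<close>

lemma factors_with_growth:
  assumes fin: "\<And>n. finite (factors x n)" and ap: "\<not> periodic x"
    and u: "u \<in> factors x (length u)" and n: "n \<ge> length u"
  shows "n + 1 - length u \<le> card (factors_with x u n)"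
  using n
proof (induction n rule: nat_induct_at_least)
  case base
  obtain i where i: "u = factor x i (length u)" using u by (rule factorsE)
  then have "factor x i (length u) \<in> factors_with x u (length u)"
    by (intro factors_withI[of 0]) auto
  moreover have finQ: "finite (factors_with x u (length u))"
    using fin factors_with_subset finite_subset by metis
  ultimately have "card (factors_with x u (length u)) \<noteq> 0" by auto
  then show ?case by simp
next
  case (Suc n)
  let ?Q = "factors_with x u n" and ?Q' = "factors_with x u (Suc n)"
  have finQ: "finite ?Q" "finite ?Q'"
    using fin factors_with_subset finite_subset by metis+
  have sub_b: "factor x i (Suc n) \<in> ?Q'" if "factor x i n \<in> ?Q" for i
    using that by (rule factors_withE) (rule factors_withI, auto)
  have sub_t: "factor x (i - 1) (Suc n) \<in> ?Q'" if iq: "factor x i n \<in> ?Q" for i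
  proof -
    obtain a where "0 \<le> a" "a + int (length u) \<le> int n" "factor x (i + a) (length u) = u"
      using iq by (rule factors_withE)
    then show ?thesis by (intro factors_withI[of "a + 1"]) auto
  qed
  have b: "?Q \<subseteq> butlast ` ?Q'"
  proof
    fix w assume w: "w \<in> ?Q"
    then obtain i where "w = factor x i n" by (auto simp: factors_with_def)
    with w sub_b show "w \<in> butlast ` ?Q'" by (metis butlast_factor imageI)
  qed
  have t: "?Q \<subseteq> tl ` ?Q'"
  proof
    fix w assume w: "w \<in> ?Q"
    then obtain i where i: "w = factor x i n" by (auto simp: factors_with_def)
    then have "w = tl (factor x (i - 1) (Suc n))" by simp
    with w i sub_t show "w \<in> tl ` ?Q'" by blast
  qed
  \<comment> \<open>Without growth, \<open>butlast\<close> and \<open>tl\<close> both map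
    \<open>?Q'\<close> exactly onto \<open>?Q\<close>. Moving a window one place in either direction
    then keeps u inside it, so all windows contain u, and injectivity of \<open>butlast\<close> on
    \<open>?Q'\<close> becomes injectivity on all words of x.\<close>
  have "card ?Q < card ?Q'"
  proof (rule ccontr)
    assume "\<not> ?thesis"
    then have le: "card ?Q' \<le> card ?Q" by simp
    have "card ?Q \<le> card (butlast ` ?Q')" "card (butlast ` ?Q') \<le> card ?Q'"
      using b finQ by (auto intro: card_mono card_image_le)
    then have eb: "card (butlast ` ?Q') = card ?Q'" "?Q = butlast ` ?Q'"
      using le card_subset_eq[OF finite_imageI[OF finQ(2)] b] by simp_all
    have "card ?Q \<le> card (tl ` ?Q')" "card (tl ` ?Q') \<le> card ?Q'"
      using t finQ by (auto intro: card_mono card_image_le)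
    then have et: "?Q = tl ` ?Q'"
      using le card_subset_eq[OF finite_imageI[OF finQ(2)] t] by simp
    obtain i0 where i0: "factor x i0 n \<in> ?Q"
    proof -
      from u obtain i where "u = factor x i (length u)" by (rule factorsE)
      then have "factor x i n \<in> ?Q" using Suc.hyps by (intro factors_withI[of 0]) auto
      then show ?thesis using that by blast
    qed
    have all: "factor x i n \<in> ?Q" for i
    proof (induction i rule: int_induct_both[of _ i0])
      case (2 i)
      then have "tl (factor x i (Suc n)) \<in> ?Q" using sub_b et by blast
      then show ?case by simp
    next
      case (3 i)
      then have "butlast (factor x (i - 1) (Suc n)) \<in> ?Q" using sub_t eb by blast
      then show ?case by simp
    qed (use i0 in simp)
    have "factors x (Suc n) \<subseteq> ?Q'" using all sub_b by (auto simp: factors_def)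
    moreover have "inj_on butlast ?Q'" using eb(1) finQ by (simp add: eq_card_imp_inj_on)
    ultimately have "inj_on butlast (factors x (Suc n))" by (rule inj_on_subset[rotated])
    then show False using inj_butlast_periodic fin ap by blast
  qed
  with Suc show ?case by simp
qed

subsection \<open>Sets of pairwise inequivalent sequences\<close>

text \<open>The condition is one-sided: an earlier point may lie in the closure of a later one. This
  is exactly what is preserved when a point outside all closures so far is appended.\<close>

abbreviation orbit_independent :: "(int \<Rightarrow> 'a) list \<Rightarrow> bool" where
  "orbit_independent \<equiv> sorted_wrt (\<lambda>x y. \<not> y \<preceq> x)"

text \<open>Some central word u of the last point y occurs in no earlier point, so the words of y
  containing u are all new. There are at least n - 2N of them, where 2N is the length of u; the loss
  2N goes into the constant C.\<close>

lemma independent_growth: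
  assumes "\<And>x n. x \<in> set xs \<Longrightarrow> finite (factors x n)" "\<And>x. x \<in> set xs \<Longrightarrow> \<not> periodic x"
    and "orbit_independent xs"
  shows "\<exists>C. \<forall>n. length xs * n \<le> card (\<Union>x\<in>set xs. factors x n) + C"
  using assms
proof (induction xs rule: rev_induct)
  case (snoc y xs)
  have "\<exists>C. \<forall>n. length xs * n \<le> card (\<Union>x\<in>set xs. factors x n) + C"
    using snoc by (auto simp: sorted_wrt_append)
  then obtain C where C: "\<And>n. length xs * n \<le> card (\<Union>x\<in>set xs. factors x n) + C" by blast
  have "\<forall>\<^sub>F n in sequentially. \<forall>x\<in>set xs. factor y (- int n) (2 * n) \<notin> factors x (2 * n)"
    using snoc.prems(3) by (intro eventually_ball_finite ballI eventually_separated)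
      (auto simp: sorted_wrt_append)
  then obtain N where N: "\<And>x. x \<in> set xs \<Longrightarrow> factor y (- int N) (2 * N) \<notin> factors x (2 * N)"
    by (auto simp: eventually_sequentially)
  define u where "u = factor y (- int N) (2 * N)"
  have lu: "length u = 2 * N" by (simp add: u_def)
  have "(length (xs @ [y])) * n \<le> card (\<Union>x\<in>set (xs @ [y]). factors x n) + (C + 2 * N)" for n
  proof -
    let ?U = "\<Union>x\<in>set xs. factors x n"
    have fin: "finite ?U" "finite (factors y n)" using snoc.prems(1) by auto
    have q: "n - 2 * N \<le> card (factors_with y u n)"
    proof (cases "n \<ge> 2 * N")
      case True
      have "u \<in> factors y (length u)" by (simp add: lu) (simp add: u_def)
      from factors_with_growth[OF _ _ this, of n] True snoc.prems(1,2) lu show ?thesis by auto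
    qed auto
    have "?U \<inter> factors_with y u n = {}"
    proof -
      have False if xw: "x \<in> set xs" "w \<in> factors x n" "w \<in> factors_with y u n" for x w
      proof -
        obtain j a where a: "w = factor y j n" "0 \<le> a" "a + int (length u) \<le> int n"
          "factor y (j + a) (length u) = u" using xw(3) by (auto simp: factors_with_def)
        then have "factor y (j + a) (length u) \<in> factors x (length u)"
          using xw(2) factors_mono by metis
        then show False using a N[OF xw(1)] lu u_def by metis
      qed
      then show ?thesis by blast
    qed
    then have "card ?U + card (factors_with y u n) = card (?U \<union> factors_with y u n)"
      using fin factors_with_subset finite_subset by (metis card_Un_disjoint)
    also have "\<dots> \<le> card (\<Union>x\<in>set (xs @ [y]). factors x n)"
      using fin factors_with_subset by (intro card_mono) fastforce+
    finally show ?thesis using C[of n] q by (simp add: algebra_simps)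
  qed
  then show ?case by blast
qed simp

text \<open>A list of greatest length cannot be extended, so no point of S lies outside all of its
  closures.\<close>

lemma independent_cover:
  assumes "\<And>xs. set xs \<subseteq> S \<Longrightarrow> orbit_independent xs \<Longrightarrow> length xs < K"
  shows "\<exists>xs. set xs \<subseteq> S \<and> orbit_independent xs \<and> length xs < K \<and> (\<forall>y\<in>S. \<exists>x\<in>set xs. y \<preceq> x)"
proof -
  let ?P = "\<lambda>xs. set xs \<subseteq> S \<and> orbit_independent xs"
  have "\<forall>xs. ?P xs \<longrightarrow> length xs < K" using assms by blast
  then have "\<exists>xs. ?P xs \<and> (\<forall>ys. ?P ys \<longrightarrow> length ys \<le> length xs)"
    using ex_has_greatest_nat[of ?P "[]" length K] by simp
  then obtain xs where *: "?P xs \<and> (\<forall>ys. ?P ys \<longrightarrow> length ys \<le> length xs)" by (elim exE)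
  note xs = conjunct1[OF *] and max = conjunct2[OF *]
  have "\<exists>x\<in>set xs. y \<preceq> x" if "y \<in> S" for y
  proof (rule ccontr)
    assume "\<not> ?thesis"
    then have "?P (xs @ [y])" using xs that by (auto simp: sorted_wrt_append)
    then have "length (xs @ [y]) \<le> length xs" using max by (elim allE impE)
    then show False by simp
  qed
  then show ?thesis using xs assms by blast
qed

text \<open>A Fine-Wilf argument: sequences of periods a and b that share one word of length at
  least a + b agree everywhere up to a shift.\<close>

lemma periodic_factors_disjoint:
  assumes "periodic p" "periodic q" "\<not> p \<preceq> q"
  shows "\<forall>\<^sub>F n in sequentially. factors p n \<inter> factors q n = {}"
proof -
  obtain a where a: "a > 0" "\<And>i. p (i + int a) = p i" using assms(1) by (auto simp: periodic_iff)
  obtain b where b: "b > 0" "\<And>i. q (i + int b) = q i" using assms(2) by (auto simp: periodic_iff)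
  have "factors p n \<inter> factors q n = {}" if n: "n \<ge> a + b" for n
  proof (rule ccontr)
    assume "\<not> ?thesis"
    then obtain i j where ij: "factor p i n = factor q j n" by (auto simp: factors_def)
    have pa: "p (m - int a) = p m" for m using a(2)[of "m - int a"] by simp
    have qb: "q (m - int b) = q m" for m using b(2)[of "m - int b"] by simp
    \<comment> \<open>Go back by a in p, cross to q, go back by b, cross to p, go forward by a,
      cross to q, go forward by b. All crossings happen at offsets n - a, n - a - b and n - b, which
      lie in the window because n is at least a + b.\<close>
    have step: "p (i + (t + int n)) = q (j + (t + int n))" if IH: "\<And>s. 0 \<le> s \<Longrightarrow> s < int n \<Longrightarrow> p (i + (t + s)) = q (j + (t + s))" for t
    proof -
      have "p (i + (t + int n)) = p (i + (t + (int n - int a)))"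
        using pa[of "i + (t + int n)"] by (simp add: algebra_simps)
      also have "\<dots> = q (j + (t + (int n - int a)))" using n a b by (intro IH) auto
      also have "\<dots> = q (j + (t + (int n - int a - int b)))"
        using qb[of "j + (t + (int n - int a))"] by (simp add: algebra_simps)
      also have "\<dots> = p (i + (t + (int n - int a - int b)))" using n a b by (intro IH[symmetric]) auto
      also have "\<dots> = p (i + (t + (int n - int b)))"
        using pa[of "i + (t + (int n - int b))"] by (simp add: algebra_simps)
      also have "\<dots> = q (j + (t + (int n - int b)))" using n a b by (intro IH) auto
      also have "\<dots> = q (j + (t + int n))"
        using qb[of "j + (t + int n)"] by (simp add: algebra_simps)
      finally show ?thesis .
    qed
    have fwd: "\<forall>s. 0 \<le> s \<and> s < int (n + t) \<longrightarrow> p (i + s) = q (j + s)" for t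
    proof (induction t)
      case 0
      then show ?case using ij by (simp add: factor_eq_iff)
    next
      case (Suc t)
      have "p (i + (int t + int n)) = q (j + (int t + int n))" using Suc by (intro step) auto
      moreover have "s < int (n + t) \<or> s = int t + int n" if "s < int (n + Suc t)" for s
        using that by auto
      ultimately show ?case using Suc by blast
    qed
    have pm: "p (m + int t * int a) = p m" for m t
    proof (induction t)
      case (Suc t)
      then show ?case using a(2)[of "m + int t * int a"] by (simp add: algebra_simps)
    qed simp
    have qm: "q (m + int t * int b) = q m" for m t
    proof (induction t)
      case (Suc t)
      then show ?case using b(2)[of "m + int t * int b"] by (simp add: algebra_simps)
    qed simp
    have all: "p (i + s) = q (j + s)" for s
    proof -
      \<comment> \<open>T is a common multiple of both periods and at least |s|, so adding it moves
        s into the range covered by \<open>fwd\<close> without changing either value.\<close>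
      define T where "T = nat \<bar>s\<bar> * a * b"
      have ab: "a * b \<ge> 1" using a(1) b(1) by (simp add: Suc_leI)
      then have "int T \<ge> \<bar>s\<bar>"
        unfolding T_def by (metis mult.assoc mult.right_neutral mult_le_mono2 nat_le_iff)
      then have "0 \<le> s + int T \<and> s + int T < int (n + nat (s + int T + 1))" by auto
      then have eqT: "p (i + (s + int T)) = q (j + (s + int T))" using fwd by blast
      have pT: "p (i + s + int (nat \<bar>s\<bar> * b) * int a) = p (i + s)" by (rule pm)
      have qT: "q (j + s + int (nat \<bar>s\<bar> * a) * int b) = q (j + s)" by (rule qm)
      show ?thesis using eqT pT qT by (simp add: T_def algebra_simps)
    qed
    have "p \<preceq> q"
    proof (rule orbit_leI)
      fix m l
      have "factor p m l = factor q (j + (m - i)) l"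
        unfolding factor_eq_iff
      proof (intro allI impI)
        fix t
        show "p (m + t) = q (j + (m - i) + t)" using all[of "m - i + t"] by (simp add: algebra_simps)
      qed
      then show "\<exists>j. factor p m l = factor q j l" by blast
    qed
    with assms show False by simp
  qed
  then show ?thesis unfolding eventually_sequentially by blast
qed

lemma card_branching:
  assumes "finite B"
  shows "card {w. \<exists>v\<in>B. \<exists>v'\<in>B. v \<noteq> v' \<and> f v = w \<and> f v' = w} + card (f ` B) \<le> card B"
proof -
  define g where "g = inv_into B f"
  have inj: "inj_on g (f ` B)" and gB: "g ` (f ` B) \<subseteq> B" and fg: "\<And>w. w \<in> f ` B \<Longrightarrow> f (g w) = w"
    unfolding g_def by (auto simp: inj_on_inv_into inv_into_into f_inv_into_f)
  let ?S = "{w. \<exists>v\<in>B. \<exists>v'\<in>B. v \<noteq> v' \<and> f v = w \<and> f v' = w}"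
  have "?S \<subseteq> f ` (B - g ` (f ` B))"
  proof
    fix w assume "w \<in> ?S"
    then obtain v v' where v: "v \<in> B" "v' \<in> B" "v \<noteq> v'" "f v = w" "f v' = w" by blast
    then obtain v'' where v'': "v'' \<in> B" "f v'' = w" "v'' \<noteq> g w" by metis
    have "v'' \<notin> g ` (f ` B)" using v'' fg by (metis imageE)
    with v'' show "w \<in> f ` (B - g ` (f ` B))" by blast
  qed
  then have "card ?S \<le> card (B - g ` (f ` B))"
    using assms by (meson card_image_le card_mono finite_Diff finite_imageI le_trans)
  also have "\<dots> = card B - card (f ` B)"
    using assms gB inj by (simp add: card_Diff_subset card_image finite_subset)
  finally show ?thesis using assms card_image_le[of B f] by linarith
qed

subsection \<open>Shifts of linear complexity\<close>

lemma int_greatest: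
  fixes P :: "int \<Rightarrow> bool"
  assumes "P i" "\<And>j. P j \<Longrightarrow> j \<le> m"
  shows "\<exists>j\<ge>i. P j \<and> (\<forall>j'>j. \<not> P j')"
proof -
  let ?S = "{j. P j \<and> i \<le> j}"
  have fin: "finite ?S" using assms(2) by (rule_tac finite_subset[of _ "{i..m}"]) auto
  have ne: "?S \<noteq> {}" using assms(1) by auto
  have mem: "Max ?S \<in> ?S" by (rule Max_in[OF fin ne])
  have "\<not> P j'" if "j' > Max ?S" for j'
  proof
    assume "P j'"
    with mem that have "j' \<in> ?S" by auto
    then show False using Max_ge[OF fin] that by fastforce
  qed
  with mem show ?thesis by blast
qed

lemma limit_factor:
  assumes "\<And>i. \<bar>i\<bar> \<le> int n \<Longrightarrow> x i = y i" "\<bar>i\<bar> + int m \<le> int n"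
  shows "factor x i m = factor y i m"
  unfolding factor_eq_iff using assms by auto

lemma shift_orbit_shift_power: "shift_orbit (shift_power s x) = shift_orbit x"
proof -
  have "shift_power s x \<in> shift_orbit x" by (simp add: shift_orbit_def)
  then show ?thesis using shift_orbit_sym shift_orbit_trans by blast
qed

definition forward_recurrent :: "(int \<Rightarrow> 'a) \<Rightarrow> bool" where
  "forward_recurrent y \<longleftrightarrow> (\<forall>i n m. \<exists>j\<ge>m. factor y j n = factor y i n)"

text \<open>The combinatorial content of the hypotheses. \<open>subseq_limit\<close> is sequential
  compactness, with the subsequence thinned so that its n-th term already agrees with the limit on
  [-n, n]. In \<open>growth\<close> the constant C is arbitrary and absorbs the bounded losses of
  the counting arguments.\<close>

locale linear_complexity_shift =
  fixes A :: "'a set" and X :: "(int \<Rightarrow> 'a) set" and k :: nat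
  assumes finite_alphabet: "finite A"
    and in_alphabet: "x \<in> X \<Longrightarrow> x i \<in> A"
    and shift_closed: "x \<in> X \<Longrightarrow> shift_power s x \<in> X"
    and subseq_limit: "(\<And>n :: nat. f n \<in> X) \<Longrightarrow>
      \<exists>y\<in>X. \<exists>r. strict_mono r \<and> (\<forall>n::nat. \<forall>i. \<bar>i\<bar> \<le> int n \<longrightarrow> f (r n) i = y i)"
    and growth: "\<forall>\<^sub>F n in sequentially. card (\<Union>x\<in>X. factors x n) + C < k * n"
    and aperiodic_dense: "x \<in> X \<Longrightarrow> \<exists>y\<in>X. \<not> periodic y \<and> factor x i n \<in> factors y n"
begin

definition lang :: "nat \<Rightarrow> 'a list set" where
  "lang n = (\<Union>x\<in>X. factors x n)"

lemma factor_in_lang: "x \<in> X \<Longrightarrow> factor x i n \<in> lang n"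
  unfolding lang_def by (rule UN_I) (assumption, rule factor_in_factors)

lemma finite_lang: "finite (lang n)"
proof -
  have "lang n \<subseteq> {w. set w \<subseteq> A \<and> length w = n}"
    using in_alphabet by (auto simp: lang_def factors_def factor_def)
  then show ?thesis using finite_lists_length_eq[OF finite_alphabet] finite_subset by blast
qed

lemma finite_factors: "x \<in> X \<Longrightarrow> finite (factors x n)"
  using finite_lang[of n] by (rule rev_finite_subset) (auto simp: lang_def)

lemma growth': "\<exists>n\<ge>N. card (lang n) + C < k * n"
proof -
  have "\<forall>\<^sub>F n in sequentially. n \<ge> N \<and> card (lang n) + C < k * n"
    using growth[of C] eventually_ge_at_top[of N] unfolding lang_def by eventually_elim simp
  then show ?thesis using eventually_happens'[OF sequentially_bot] by blast
qed

lemma independent_length: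
  assumes "set xs \<subseteq> {x \<in> X. \<not> periodic x}" "orbit_independent xs"
  shows "length xs < k"
proof -
  obtain C where C: "\<And>n. length xs * n \<le> card (\<Union>x\<in>set xs. factors x n) + C"
    using independent_growth[of xs] assms finite_factors by blast
  obtain n where n: "card (lang n) + C < k * n" using growth' by blast
  have "card (\<Union>x\<in>set xs. factors x n) \<le> card (lang n)"
    using assms finite_lang by (intro card_mono) (auto simp: lang_def)
  then have "length xs * n < k * n" using C[of n] n by linarith
  then show ?thesis by simp
qed

section \<open>Special words: left special for \<open>tl\<close>, right special for
  \<open>butlast\<close>\<close>

definition special :: "('a list \<Rightarrow> 'a list) \<Rightarrow> nat \<Rightarrow> 'a list set" where
  "special f n = {w. \<exists>v\<in>lang (Suc n). \<exists>v'\<in>lang (Suc n). v \<noteq> v' \<and> f v = w \<and> f v' = w}"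

lemma tl_lang: "tl ` lang (Suc n) = lang n"
  unfolding lang_def image_UN by (simp add: tl_factors)

lemma butlast_lang: "butlast ` lang (Suc n) = lang n"
  unfolding lang_def image_UN by (simp add: butlast_factors)

lemma finite_special: "finite (special f n)"
proof -
  have "special f n \<subseteq> f ` lang (Suc n)" by (auto simp: special_def)
  then show ?thesis using finite_lang finite_subset by blast
qed

text \<open>If the complexity rose by at least k at every step from N on, it would be at least k(n -
  N), against \<open>growth\<close> with C = kN. At a length where it rises by less,
  \<open>card_branching\<close> bounds both kinds of special words.\<close>

lemma few_special:
  obtains n where "n \<ge> N" "card (special tl n) < k" "card (special butlast n) < k"
proof -
  have "\<exists>n\<ge>N. card (lang (Suc n)) < card (lang n) + k"
  proof (rule ccontr)
    assume "\<not> ?thesis"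
    then have step: "card (lang n) + k \<le> card (lang (Suc n))" if "n \<ge> N" for n
      using that by (meson not_le)
    have lower: "k * m \<le> card (lang (N + m))" for m
    proof (induction m)
      case (Suc m)
      then show ?case using step[of "N + m"] by simp
    qed simp
    obtain n where n: "n \<ge> N" "card (lang n) + k * N < k * n" using growth' by blast
    have "k * (n - N) + k * N = k * n"
      using n(1) by (metis add_mult_distrib2 le_add_diff_inverse2)
    then show False using lower[of "n - N"] n by simp
  qed
  then obtain n where n: "n \<ge> N" "card (lang (Suc n)) < card (lang n) + k" by blast
  have "card (special tl n) + card (lang n) \<le> card (lang (Suc n))"
    "card (special butlast n) + card (lang n) \<le> card (lang (Suc n))"
    using card_branching[OF finite_lang[of "Suc n"], of tl] card_branching[OF finite_lang[of "Suc n"], of butlast]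
    by (simp_all add: special_def tl_lang butlast_lang)
  with n that show ?thesis by (metis add.commute add_less_cancel_left le_less_trans)
qed

text \<open>Some aperiodic y shares a word of length n with p. If no word of p of that length were
  special, the common word would extend uniquely on both sides, and p would be a shift of y.\<close>

lemma periodic_special:
  assumes p: "p \<in> X" "periodic p"
  shows "(special tl n \<union> special butlast n) \<inter> factors p n \<noteq> {}"
proof
  assume none: "(special tl n \<union> special butlast n) \<inter> factors p n = {}"
  obtain y j where y: "y \<in> X" "\<not> periodic y" "factor p 0 n = factor y j n"
    using aperiodic_dense[OF p(1)] by (metis factorsE)
  have right: "factor p t (Suc n) = factor y s (Suc n)" if "factor p t n = factor y s n" for s t
  proof (rule ccontr)
    assume "factor p t (Suc n) \<noteq> factor y s (Suc n)"
    then have "factor p t n \<in> special butlast n"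
      unfolding special_def using that p y by (auto intro!: bexI factor_in_lang)
    with none show False by auto
  qed
  have left: "factor p (t - 1) (Suc n) = factor y (s - 1) (Suc n)"
    if "factor p t n = factor y s n" for s t
  proof (rule ccontr)
    assume "factor p (t - 1) (Suc n) \<noteq> factor y (s - 1) (Suc n)"
    then have "factor p t n \<in> special tl n"
      unfolding special_def using that p y by (auto intro!: bexI factor_in_lang)
    with none show False by auto
  qed
  have all: "factor p t n = factor y (j + t) n" for t
  proof (induction t rule: int_induct_both[of _ 0])
    case (2 t)
    from arg_cong[OF right[OF this], of tl] show ?case by (simp add: algebra_simps)
  next
    case (3 t)
    from arg_cong[OF left[OF this], of butlast] show ?case by (simp add: algebra_simps)
  qed (use y in simp)
  have "p t = y (j + t)" for t
    using right[OF all[of t]] by (simp add: factor_Suc')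
  then have "p = shift_power j y" by (simp add: fun_eq_iff shift_power_apply add.commute)
  then show False using p y periodic_shift_power by metis
qed

text \<open>At a large length the orbits have no words in common, yet each contains a special word.
  So there are at most as many orbits as special words, fewer than k of each kind.\<close>

lemma independent_periodic_length:
  assumes ps: "set ps \<subseteq> {p \<in> X. periodic p}" "orbit_independent ps"
  shows "length ps < 2 * k"
proof -
  have dist: "distinct ps" and indep: "\<And>p q. p \<in> set ps \<Longrightarrow> q \<in> set ps \<Longrightarrow> p \<noteq> q \<Longrightarrow> \<not> p \<preceq> q \<or> \<not> q \<preceq> p"
    using ps(2) by (induction ps) auto
  have "\<forall>\<^sub>F n in sequentially. \<forall>p\<in>set ps. \<forall>q\<in>set ps. p \<noteq> q \<longrightarrow> factors p n \<inter> factors q n = {}"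
  proof (intro eventually_ball_finite ballI finite_set)
    fix p q assume pq: "p \<in> set ps" "q \<in> set ps"
    show "\<forall>\<^sub>F n in sequentially. p \<noteq> q \<longrightarrow> factors p n \<inter> factors q n = {}"
    proof (cases "p = q")
      case False
      have per: "periodic p" "periodic q" using pq ps(1) by auto
      from indep[OF pq False] show ?thesis
      proof
        assume "\<not> p \<preceq> q"
        from periodic_factors_disjoint[OF per this] show ?thesis by eventually_elim simp
      next
        assume "\<not> q \<preceq> p"
        from periodic_factors_disjoint[OF per(2,1) this] show ?thesis by eventually_elim blast
      qed
    qed simp
  qed
  then obtain N where N: "\<And>n p q. n \<ge> N \<Longrightarrow> p \<in> set ps \<Longrightarrow> q \<in> set ps \<Longrightarrow> p \<noteq> q \<Longrightarrow>
      factors p n \<inter> factors q n = {}"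
    unfolding eventually_sequentially by blast
  obtain n where n: "n \<ge> N" "card (special tl n) < k" "card (special butlast n) < k"
    by (rule few_special)
  define g where "g p = (SOME w. w \<in> (special tl n \<union> special butlast n) \<inter> factors p n)" for p
  have g: "g p \<in> (special tl n \<union> special butlast n) \<inter> factors p n" if "p \<in> set ps" for p
    unfolding g_def using periodic_special[of p n] that ps(1) by (intro some_in_eq[THEN iffD2]) auto
  have "inj_on g (set ps)"
  proof (rule inj_onI)
    fix p q assume pq: "p \<in> set ps" "q \<in> set ps" "g p = g q"
    then have "g p \<in> factors p n \<inter> factors q n" using g by force
    then show "p = q" using N[OF n(1) pq(1,2)] by blast
  qed
  then have "card (set ps) = card (g ` set ps)" by (simp add: card_image)
  also have "\<dots> \<le> card (special tl n \<union> special butlast n)"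
    using g finite_special by (intro card_mono) auto
  also have "\<dots> \<le> card (special tl n) + card (special butlast n)" by (rule card_Un_le)
  also have "\<dots> < 2 * k" using n by simp
  finally show ?thesis using dist by (simp add: distinct_card)
qed

text \<open>The points below x that do not have x below them are covered by finitely many aperiodic
  and finitely many periodic points, and x is below none of these: a periodic point has only
  periodic points below it. One central word of x therefore avoids them all, and any y below x that
  contains it has a dense orbit in the closure of x.\<close>

lemma separating_factor:
  assumes x: "x \<in> X" "\<not> periodic x"
  obtains u where "u \<in> factors x (length u)"
    "\<And>y. y \<in> X \<Longrightarrow> y \<preceq> x \<Longrightarrow> u \<in> factors y (length u) \<Longrightarrow> x \<preceq> y"
proof -
  let ?S = "{y \<in> X. \<not> periodic y \<and> y \<preceq> x \<and> \<not> x \<preceq> y}" and ?P = "{p \<in> X. periodic p}"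
  have len: "length xs < k" if "set xs \<subseteq> ?S" "orbit_independent xs" for xs
    using that by (intro independent_length) auto
  have "\<exists>ys. set ys \<subseteq> ?S \<and> orbit_independent ys \<and> length ys < k \<and> (\<forall>y\<in>?S. \<exists>z\<in>set ys. y \<preceq> z)"
    by (rule independent_cover) (rule len)
  then obtain ys where
    *: "set ys \<subseteq> ?S \<and> orbit_independent ys \<and> length ys < k \<and> (\<forall>y\<in>?S. \<exists>z\<in>set ys. y \<preceq> z)"
    by (elim exE)
  note ys = conjunct1[OF *] conjunct2[OF conjunct2[OF conjunct2[OF *]], rule_format]
  have "\<exists>ps. set ps \<subseteq> ?P \<and> orbit_independent ps \<and> length ps < 2 * k \<and> (\<forall>p\<in>?P. \<exists>q\<in>set ps. p \<preceq> q)"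
    by (rule independent_cover) (rule independent_periodic_length)
  then obtain ps where
    *: "set ps \<subseteq> ?P \<and> orbit_independent ps \<and> length ps < 2 * k \<and> (\<forall>p\<in>?P. \<exists>q\<in>set ps. p \<preceq> q)"
    by (elim exE)
  note ps = conjunct1[OF *] conjunct2[OF conjunct2[OF conjunct2[OF *]], rule_format]
  have "\<forall>\<^sub>F n in sequentially. \<forall>z\<in>set ys \<union> set ps. factor x (- int n) (2 * n) \<notin> factors z (2 * n)"
    using ys(1) ps(1) x(2) periodic_orbit_le
    by (intro eventually_ball_finite ballI eventually_separated) auto
  then obtain n where n: "\<And>z. z \<in> set ys \<union> set ps \<Longrightarrow> factor x (- int n) (2 * n) \<notin> factors z (2 * n)"
    unfolding eventually_sequentially by blast
  let ?u = "factor x (- int n) (2 * n)"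
  have "x \<preceq> y" if y: "y \<in> X" "y \<preceq> x" "?u \<in> factors y (length ?u)" for y
  proof (rule ccontr)
    assume "\<not> x \<preceq> y"
    have "\<exists>z\<in>set ys \<union> set ps. y \<preceq> z"
    proof (cases "periodic y")
      case True
      then have "\<exists>z\<in>set ps. y \<preceq> z" using y(1) by (intro ps(2)) simp
      then show ?thesis by blast
    next
      case False
      then have "\<exists>z\<in>set ys. y \<preceq> z" using y(1,2) \<open>\<not> x \<preceq> y\<close> by (intro ys(2)) simp
      then show ?thesis by blast
    qed
    then obtain z where "z \<in> set ys \<union> set ps" "y \<preceq> z" by blast
    then show False using n y(3) unfolding orbit_le_def by (metis length_factor subsetD)
  qed
  then show ?thesis using that[of ?u] by simp
qed

text \<open>Let F consist of k such points. The last occurrence of u inside a long window reveals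
  the position of the window, and its central part reveals the point, so F alone supplies about k(n
  - 2N) words of length n, which contradicts \<open>growth\<close>.\<close>

lemma finite_last_occurrence:
  "finite {y \<in> X. factor y 0 (length u) = u \<and> (\<forall>i>0. factor y i (length u) \<noteq> u)}"
proof (rule ccontr)
  define S where "S = {y \<in> X. factor y 0 (length u) = u \<and> (\<forall>i>0. factor y i (length u) \<noteq> u)}"
  assume "infinite {y \<in> X. factor y 0 (length u) = u \<and> (\<forall>i>0. factor y i (length u) \<noteq> u)}"
  then have "infinite S" unfolding S_def .
  then obtain F where "F \<subseteq> S" and F: "finite F" "card F = k"
    using infinite_arbitrarily_large by blast
  then have FX: "\<And>y. y \<in> F \<Longrightarrow> y \<in> X" and Fu: "\<And>y. y \<in> F \<Longrightarrow> factor y 0 (length u) = u"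
    and Flast: "\<And>y i. y \<in> F \<Longrightarrow> i > 0 \<Longrightarrow> factor y i (length u) \<noteq> u"
    by (auto simp: S_def)
  have "\<forall>\<^sub>F n in sequentially. \<forall>y\<in>F. \<forall>z\<in>F. y \<noteq> z \<longrightarrow>
      factor y (- int n) (2 * n) \<noteq> factor z (- int n) (2 * n)"
  proof (intro eventually_ball_finite F ballI)
    fix y z :: "int \<Rightarrow> 'a"
    show "\<forall>\<^sub>F n in sequentially. y \<noteq> z \<longrightarrow>
        factor y (- int n) (2 * n) \<noteq> factor z (- int n) (2 * n)"
      using eventually_distinct_factor[of y z] by (cases "y = z") simp_all
  qed
  then obtain N0 where N0: "\<And>n y z. n \<ge> N0 \<Longrightarrow> y \<in> F \<Longrightarrow> z \<in> F \<Longrightarrow> y \<noteq> z \<Longrightarrow>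
      factor y (- int n) (2 * n) \<noteq> factor z (- int n) (2 * n)"
    unfolding eventually_sequentially by blast
  \<comment> \<open>N0 separates the points of F. The extra length of u keeps the occurrence of u at
    0 inside every window that starts at -t with t in {N..n - N}.\<close>
  define N where "N = N0 + length u"
  obtain n where n: "n \<ge> 2 * N" "card (lang n) + k * (2 * N) < k * n" using growth' by blast
  define h where "h = (\<lambda>(y :: int \<Rightarrow> 'a, t). factor y (- int t) n)"
  have "inj_on h (F \<times> {N..n - N})"
  proof (rule inj_onI, clarify)
    fix y t z s assume y: "y \<in> F" "t \<in> {N..n - N}" and z: "z \<in> F" "s \<in> {N..n - N}"
      and eq: "h (y, t) = h (z, s)"
    \<comment> \<open>Equal windows at offsets t < s would copy the occurrence of u at 0 in z to the
      positive position s - t in y.\<close>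
    have *: False if yz: "y \<in> F" "z \<in> F" "s \<in> {N..n - N}" "t < s"
      "factor y (- int t) n = factor z (- int s) n" for y z s t
    proof -
      have "factor y (- int t + int s) (length u) = factor z (- int s + int s) (length u)"
        using yz(3,4) n by (intro factor_sub[OF yz(5)]) (auto simp: N_def)
      then have "factor y (int s - int t) (length u) = u" using Fu[OF yz(2)] by simp
      moreover have "int s - int t > 0" using yz(4) by simp
      ultimately show False using Flast[OF yz(1)] by blast
    qed
    have eq': "factor y (- int t) n = factor z (- int s) n" using eq by (simp add: h_def)
    have st: "s = t"
      using *[OF y(1) z(1) z(2) _ eq'] *[OF z(1) y(1) y(2) _ eq'[symmetric]] by (metis linorder_neqE_nat)
    have "factor y (- int t + (int t - int N)) (2 * N) = factor z (- int s + (int t - int N)) (2 * N)"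
      using y(2) n by (intro factor_sub[OF eq']) auto
    then have "y = z" using N0[of N y z] y z st by (auto simp: N_def)
    with st show "y = z \<and> t = s" by simp
  qed
  moreover have "h ` (F \<times> {N..n - N}) \<subseteq> lang n"
    using FX by (auto simp: h_def intro: factor_in_lang)
  ultimately have "card (F \<times> {N..n - N}) \<le> card (lang n)"
    using finite_lang by (metis card_image card_mono)
  then have "k * (Suc (n - N) - N) \<le> card (lang n)" by (simp add: card_cartesian_product F(2))
  moreover have "k * (n - 2 * N) \<le> k * (Suc (n - N) - N)" by (intro mult_le_mono2) auto
  moreover have "k * (n - 2 * N) + k * (2 * N) = k * n"
    using n(1) by (metis add_mult_distrib2 le_add_diff_inverse2)
  ultimately show False using n(2) by linarith
qed

section \<open>Recurrence and minimality\<close>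

lemma limit_orbit_le:
  assumes "\<And>n i. \<bar>i\<bar> \<le> int n \<Longrightarrow> shift_power (s n) x i = y i"
  shows "y \<preceq> x"
proof (rule orbit_leI)
  fix i n
  have "factor (shift_power (s (nat \<bar>i\<bar> + n)) x) i n = factor y i n"
    by (intro limit_factor[of "nat \<bar>i\<bar> + n"] assms) auto
  then show "\<exists>j. factor y i n = factor x j n" by (metis factor_shift_power)
qed

text \<open>If u occurred arbitrarily far to the right in y, a limit z of shifts of y by such
  positions would contain u and hence have all words of y. These words would then occur in y near
  positions tending to the right, making y forward recurrent. So u has a last occurrence, and s is
  its position.\<close>

lemma last_occurrence:
  assumes x: "x \<in> X" and u: "u \<in> factors x (length u)"
    "\<And>y. y \<in> X \<Longrightarrow> y \<preceq> x \<Longrightarrow> u \<in> factors y (length u) \<Longrightarrow> x \<preceq> y"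
    and y: "y \<in> X" "y \<preceq> x" "x \<preceq> y" "\<not> forward_recurrent y"
  obtains s where "factor (shift_power s y) 0 (length u) = u"
    "\<And>i. i > 0 \<Longrightarrow> factor (shift_power s y) i (length u) \<noteq> u"
proof -
  have "\<exists>m. \<forall>j\<ge>m. factor y j (length u) \<noteq> u"
  proof (rule ccontr)
    assume "\<not> ?thesis"
    then have "\<forall>m::nat. \<exists>j\<ge>int m. factor y j (length u) = u" by blast
    then obtain j where j: "\<And>m::nat. j m \<ge> int m" "\<And>m. factor y (j m) (length u) = u" by metis
    obtain z r where z: "z \<in> X" "strict_mono r"
      and zl: "\<And>n i. \<bar>i\<bar> \<le> int n \<Longrightarrow> shift_power (j (r n)) y i = z i"
      using subseq_limit[of "\<lambda>n. shift_power (j n) y"] shift_closed y(1) by metis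
    have fz: "factor y (i + j (r n)) m = factor z i m" if "\<bar>i\<bar> + int m \<le> int n" for i n m
      using limit_factor[of n "shift_power (j (r n)) y" z, OF zl that] by (simp add: factor_shift_power)
    have "z \<preceq> y" by (rule limit_orbit_le[OF zl])
    moreover have "u \<in> factors z (length u)"
      using fz[of 0 "length u" "length u"] j(2) by (metis add_0 abs_zero factor_in_factors order_refl)
    ultimately have "y \<preceq> z" using u(2) z(1) y orbit_le_trans by blast
    have "forward_recurrent y"
      unfolding forward_recurrent_def
    proof (intro allI)
      fix i n m
      obtain i' where i': "factor y i n = factor z i' n" using \<open>y \<preceq> z\<close> by (rule orbit_leD)
      \<comment> \<open>The radius contains the word of z at i', and since j (r N) is at least N,
        the copy of this word in y starts at m or later.\<close>
      define N where "N = nat (\<bar>i'\<bar> + int n + \<bar>m\<bar>)"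
      have "factor y (i' + j (r N)) n = factor y i n"
        using fz[of i' n N] i' by (simp add: N_def)
      moreover have "i' + j (r N) \<ge> m"
      proof -
        have "int N = \<bar>i'\<bar> + int n + \<bar>m\<bar>" by (simp add: N_def)
        then show ?thesis using j(1)[of "r N"] seq_suble[OF z(2), of N] by linarith
      qed
      ultimately show "\<exists>j\<ge>m. factor y j n = factor y i n" by blast
    qed
    with y(4) show False by simp
  qed
  then obtain m where m: "\<And>j. j \<ge> m \<Longrightarrow> factor y j (length u) \<noteq> u" by blast
  obtain i where i: "factor y i (length u) = u"
    using u(1) y(3) unfolding orbit_le_def by (metis factorsE subsetD)
  have "j \<le> m" if "factor y j (length u) = u" for j using m[of j] that by linarith
  from int_greatest[of "\<lambda>j. factor y j (length u) = u", OF i this]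
  obtain s where "factor y s (length u) = u" "\<And>j. j > s \<Longrightarrow> factor y j (length u) \<noteq> u" by blast
  then show ?thesis by (intro that[of s]) (simp_all add: factor_shift_power)
qed

text \<open>If x is not below z, the separating word u is absent from z. Recurrence puts arbitrarily
  long words of z to the right of an occurrence of u in x, so u has occurrences followed by
  arbitrarily long gaps. A limit y at such occurrences has u at 0 and never afterwards; but u makes
  the orbit of y dense in the closure of x, so y should be forward recurrent.\<close>

lemma recurrent_minimal:
  assumes x: "x \<in> X" "\<not> periodic x"
    and rec: "\<And>y. y \<in> X \<Longrightarrow> y \<preceq> x \<Longrightarrow> x \<preceq> y \<Longrightarrow> forward_recurrent y"
    and z: "z \<in> X" "z \<preceq> x"
  shows "x \<preceq> z"
proof (rule ccontr)
  assume not: "\<not> x \<preceq> z"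
  obtain u where u: "u \<in> factors x (length u)"
    "\<And>y. y \<in> X \<Longrightarrow> y \<preceq> x \<Longrightarrow> u \<in> factors y (length u) \<Longrightarrow> x \<preceq> y"
    using separating_factor[OF x] by metis
  let ?l = "length u"
  have uz: "factor z i ?l \<noteq> u" for i using u(2) z not by (metis factor_in_factors)
  obtain j0 where j0: "factor x j0 ?l = u" using u(1) by (metis factorsE)
  have xrec: "forward_recurrent x" using rec x by simp
  have "\<exists>j. factor x j ?l = u \<and> (\<forall>t. 0 < t \<and> t + int ?l \<le> int N \<longrightarrow> factor x (j + t) ?l \<noteq> u)" for N
  proof -
    obtain i' where "factor z 0 N = factor x i' N" using z(2) by (rule orbit_leD)
    then obtain i where i: "i \<ge> j0 + 1" "factor x i N = factor z 0 N"
      using xrec unfolding forward_recurrent_def by metis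
    obtain j where j: "factor x j ?l = u \<and> j < i" "\<And>j'. j' > j \<Longrightarrow> \<not> (factor x j' ?l = u \<and> j' < i)"
      using int_greatest[of "\<lambda>j. factor x j ?l = u \<and> j < i" j0 i] j0 i(1) by auto
    \<comment> \<open>Before i this is the choice of j as the last occurrence; from i on, the word
      lies in the copy of a word of z, which is free of u.\<close>
    have "factor x (j + t) ?l \<noteq> u" if t: "0 < t" "t + int ?l \<le> int N" for t
    proof (cases "j + t < i")
      case True
      then show ?thesis using j(2)[of "j + t"] t by auto
    next
      case False
      have "factor x (i + (j + t - i)) ?l = factor z (0 + (j + t - i)) ?l"
        using False t j(1) by (intro factor_sub[OF i(2)]) auto
      then show ?thesis using uz by simp
    qed
    with j show ?thesis by blast
  qed
  then obtain j where j: "\<And>N. factor x (j N) ?l = u"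
    "\<And>N t. 0 < t \<Longrightarrow> t + int ?l \<le> int N \<Longrightarrow> factor x (j N + t) ?l \<noteq> u" by metis
  obtain y r where y: "y \<in> X" "strict_mono r"
    and yl: "\<And>n i. \<bar>i\<bar> \<le> int n \<Longrightarrow> shift_power (j (r n)) x i = y i"
    using subseq_limit[of "\<lambda>n. shift_power (j n) x"] shift_closed x(1) by metis
  have fy: "factor x (i + j (r n)) m = factor y i m" if "\<bar>i\<bar> + int m \<le> int n" for i n m
    using limit_factor[of n "shift_power (j (r n)) x" y, OF yl that] by (simp add: factor_shift_power)
  have yx: "y \<preceq> x" by (rule limit_orbit_le[OF yl])
  have y0: "factor y 0 ?l = u" using fy[of 0 ?l ?l] j(1) by simp
  have "x \<preceq> y" using u(2)[OF y(1) yx] y0 by (metis factor_in_factors)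
  with rec y yx have "forward_recurrent y" by blast
  then obtain t where t: "t \<ge> 1" "factor y t ?l = u" using y0 unfolding forward_recurrent_def by metis
  define n where "n = nat t + ?l"
  have "factor x (j (r n) + t) ?l = u" using fy[of t ?l n] t by (simp add: n_def add.commute)
  moreover have "t + int ?l \<le> int (r n)" using seq_suble[OF y(2), of n] t by (simp add: n_def)
  ultimately show False using j(2)[of t "r n"] t by simp
qed

section \<open>Left special right-infinite sequences and asymptotic pairs\<close>

definition special_futures :: "(nat \<Rightarrow> 'a) set" where
  "special_futures = {g. \<forall>n. map g [0..<n] \<in> special tl n}"

text \<open>Any k of these sequences have k different prefixes at all large lengths, but at
  arbitrarily large lengths there are fewer than k left special words.\<close>

lemma finite_special_futures: "finite special_futures"
proof (rule ccontr)
  assume "infinite special_futures"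
  then obtain F where F: "F \<subseteq> special_futures" "finite F" "card F = k"
    using infinite_arbitrarily_large by blast
  have "\<forall>\<^sub>F n in sequentially. \<forall>g\<in>F. \<forall>h\<in>F. g \<noteq> h \<longrightarrow> map g [0..<n] \<noteq> map h [0..<n]"
  proof (intro eventually_ball_finite F ballI)
    fix g h :: "nat \<Rightarrow> 'a"
    show "\<forall>\<^sub>F n in sequentially. g \<noteq> h \<longrightarrow> map g [0..<n] \<noteq> map h [0..<n]"
    proof (cases "g = h")
      case False
      then obtain i where "g i \<noteq> h i" by auto
      then have "map g [0..<n] \<noteq> map h [0..<n]" if "n \<ge> Suc i" for n using that by auto
      then show ?thesis unfolding eventually_sequentially by blast
    qed simp
  qed
  then obtain N where N: "\<And>n g h. n \<ge> N \<Longrightarrow> g \<in> F \<Longrightarrow> h \<in> F \<Longrightarrow> g \<noteq> h \<Longrightarrow> map g [0..<n] \<noteq> map h [0..<n]"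
    unfolding eventually_sequentially by blast
  obtain n where n: "n \<ge> N" "card (special tl n) < k" by (rule few_special)
  have "inj_on (\<lambda>g. map g [0..<n]) F" using N[OF n(1)] by (intro inj_onI) blast
  moreover have "(\<lambda>g. map g [0..<n]) ` F \<subseteq> special tl n" using F(1) by (auto simp: special_futures_def)
  ultimately have "card F \<le> card (special tl n)" using finite_special by (metis card_image card_mono)
  with F n show False by simp
qed

text \<open>The different letters at the last disagreement s are two left extensions of the common
  future, which therefore starts at s + 1.\<close>

lemma special_futureI:
  assumes "y \<in> X" "z \<in> X" "y s \<noteq> z s" "\<And>i. i > s \<Longrightarrow> y i = z i"
  shows "(\<lambda>n. y (s + 1 + int n)) \<in> special_futures"
proof -
  have "factor y (s + 1) n \<in> special tl n" for n
  proof -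
    have "factor y (s + 1) n = factor z (s + 1) n" using assms(4) by (auto simp: factor_eq_iff)
    moreover have "factor y s (Suc n) \<noteq> factor z s (Suc n)" using assms(3) by (simp add: factor_Suc')
    ultimately show ?thesis
      unfolding special_def using assms(1,2) by (auto intro!: bexI factor_in_lang)
  qed
  then show ?thesis by (simp add: special_futures_def factor_def)
qed

text \<open>By \<open>inj_tl_periodic\<close> an aperiodic x has left special words of every length.
  Centre x at two occurrences with different preceding letters and pass to the limit: the limits
  differ at -1 and agree from 0 on.\<close>

lemma asymptotic_pair:
  assumes x: "x \<in> X" "\<not> periodic x"
  obtains y z where "y \<in> X" "z \<in> X" "y \<preceq> x" "y \<noteq> z" "\<And>i. i \<ge> 0 \<Longrightarrow> y i = z i"
proof -
  have "\<exists>i j. factor x i n = factor x j n \<and> x (i - 1) \<noteq> x (j - 1)" for n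
  proof -
    have "\<not> inj_on tl (factors x (Suc n))" using inj_tl_periodic finite_factors x by blast
    then obtain i j where ij: "tl (factor x i (Suc n)) = tl (factor x j (Suc n))"
        "factor x i (Suc n) \<noteq> factor x j (Suc n)"
      unfolding inj_on_def by (metis factorsE)
    then have "factor x (i + 1) n = factor x (j + 1) n" "x (i + 1 - 1) \<noteq> x (j + 1 - 1)"
      by (auto simp: factor_Suc')
    then show ?thesis by blast
  qed
  then obtain i j where ij: "\<And>n. factor x (i n) n = factor x (j n) n" "\<And>n. x (i n - 1) \<noteq> x (j n - 1)"
    by metis
  obtain y r where y: "y \<in> X" "strict_mono r"
    and yl: "\<And>n t. \<bar>t\<bar> \<le> int n \<Longrightarrow> shift_power (i (r n)) x t = y t"
    using subseq_limit[of "\<lambda>n. shift_power (i n) x"] shift_closed x(1) by metis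
  \<comment> \<open>The second subsequence is extracted from the first, so that both limits are
    reached along the same indices r (r' n).\<close>
  obtain z r' where z: "z \<in> X" "strict_mono r'"
    and zl: "\<And>n t. \<bar>t\<bar> \<le> int n \<Longrightarrow> shift_power (j (r (r' n))) x t = z t"
    using subseq_limit[of "\<lambda>n. shift_power (j (r n)) x"] shift_closed x(1) by metis
  have yl': "shift_power (i (r (r' n))) x t = y t" if "\<bar>t\<bar> \<le> int n" for n t
    using yl[of t "r' n"] that seq_suble[OF z(2), of n] by simp
  have rr: "n \<le> r (r' n)" for n
    using seq_suble[OF y(2), of "r' n"] seq_suble[OF z(2), of n] by simp
  have "y (- 1) \<noteq> z (- 1)"
    using yl'[of "- 1" 1] zl[of "- 1" 1] ij(2)[of "r (r' 1)"] by (simp add: shift_power_apply add.commute)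
  then have ne: "y \<noteq> z" by auto
  have agree: "y t = z t" if "t \<ge> 0" for t
  proof -
    define n where "n = nat t + 1"
    have "x (i (r (r' n)) + t) = x (j (r (r' n)) + t)"
      using ij(1)[of "r (r' n)"] rr[of n] that unfolding factor_eq_iff n_def by auto
    then show ?thesis
      using yl'[of t n] zl[of t n] that by (simp add: shift_power_apply add.commute n_def)
  qed
  show ?thesis using that[OF y(1) z(1) limit_orbit_le[OF yl] ne agree] by simp
qed

end

subsection \<open>Block maps\<close>

lemma finite_image_factor:
  assumes "finite (c ` S)" "\<And>a b. a \<in> S \<Longrightarrow> b \<in> S \<Longrightarrow> c a = c b \<Longrightarrow> g a = g b"
  shows "finite (g ` S)"
proof -
  define h where "h z = g (SOME a. a \<in> S \<and> c a = z)" for z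
  have "g a = h (c a)" if "a \<in> S" for a
  proof -
    have "(SOME b. b \<in> S \<and> c b = c a) \<in> S \<and> c (SOME b. b \<in> S \<and> c b = c a) = c a"
      by (rule someI[of _ a]) (use that in simp)
    then show ?thesis unfolding h_def using assms(2) that by metis
  qed
  then have "g ` S \<subseteq> h ` (c ` S)" by blast
  then show ?thesis using assms(1) finite_subset finite_imageI by blast
qed

context linear_complexity_shift
begin

text \<open>A sliding block code in the sense of Curtis-Hedlund-Lyndon. Comparing position i of one
  point with position j of another builds commutation with the shift into the locality
  condition.\<close>

definition block_map :: "((int \<Rightarrow> 'a) \<Rightarrow> int \<Rightarrow> 'a) \<Rightarrow> bool" where
  "block_map \<phi> \<longleftrightarrow> (\<forall>x\<in>X. \<phi> x \<in> X) \<and> (\<exists>N. \<forall>x\<in>X. \<forall>y\<in>X. \<forall>i j.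
     factor x (i - int N) (2 * N + 1) = factor y (j - int N) (2 * N + 1) \<longrightarrow> \<phi> x i = \<phi> y j)"

definition auto_map :: "((int \<Rightarrow> 'a) \<Rightarrow> int \<Rightarrow> 'a) \<Rightarrow> bool" where
  "auto_map \<phi> \<longleftrightarrow> block_map \<phi> \<and> (\<exists>\<psi>. block_map \<psi> \<and> (\<forall>x\<in>X. \<psi> (\<phi> x) = x \<and> \<phi> (\<psi> x) = x))"

definition maximal :: "(int \<Rightarrow> 'a) \<Rightarrow> bool" where
  "maximal x \<longleftrightarrow> x \<in> X \<and> (\<forall>y\<in>X. x \<preceq> y \<longrightarrow> y \<preceq> x)"

lemma block_map_closed: "block_map \<phi> \<Longrightarrow> x \<in> X \<Longrightarrow> \<phi> x \<in> X"
  by (simp add: block_map_def)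

lemma block_map_factor:
  assumes "block_map \<phi>"
  obtains N where "\<And>x y i j n. x \<in> X \<Longrightarrow> y \<in> X \<Longrightarrow>
    factor x (i - int N) (n + 2 * N) = factor y (j - int N) (n + 2 * N) \<Longrightarrow>
    factor (\<phi> x) i n = factor (\<phi> y) j n"
proof -
  obtain N where N: "\<And>x y i j. x \<in> X \<Longrightarrow> y \<in> X \<Longrightarrow>
     factor x (i - int N) (2 * N + 1) = factor y (j - int N) (2 * N + 1) \<Longrightarrow> \<phi> x i = \<phi> y j"
    using assms(1) unfolding block_map_def by blast
  have "factor (\<phi> x) i n = factor (\<phi> y) j n" if xy: "x \<in> X" "y \<in> X"
    and eq: "factor x (i - int N) (n + 2 * N) = factor y (j - int N) (n + 2 * N)" for x y i j n
    unfolding factor_eq_iff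
  proof (intro allI impI)
    fix m assume m: "0 \<le> m \<and> m < int n"
    have "factor x (i - int N + m) (2 * N + 1) = factor y (j - int N + m) (2 * N + 1)"
      using m by (intro factor_sub[OF eq]) auto
    then have "factor x (i + m - int N) (2 * N + 1) = factor y (j + m - int N) (2 * N + 1)"
      by (simp add: algebra_simps)
    then show "\<phi> x (i + m) = \<phi> y (j + m)" by (rule N[OF xy])
  qed
  then show ?thesis using that by blast
qed

text \<open>The window is large enough to determine the value of \<open>\<phi>\<close> at its centre and the value
  of \<open>\<phi>'\<close> at distance \<open>d\<close> from it.\<close>

lemma block_map_pair:
  assumes "block_map \<phi>" "block_map \<phi>'"
  obtains N where "\<And>x y i j. x \<in> X \<Longrightarrow> y \<in> X \<Longrightarrow>
    factor x (i - int N) (2 * N + 1) = factor y (j - int N) (2 * N + 1) \<Longrightarrow>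
    \<phi> x i = \<phi> y j \<and> \<phi>' x (i + d) = \<phi>' y (j + d)"
proof -
  obtain M where M: "\<And>x y i j. x \<in> X \<Longrightarrow> y \<in> X \<Longrightarrow>
     factor x (i - int M) (2 * M + 1) = factor y (j - int M) (2 * M + 1) \<Longrightarrow> \<phi> x i = \<phi> y j"
    using assms(1) unfolding block_map_def by blast
  obtain M' where M': "\<And>x y i j. x \<in> X \<Longrightarrow> y \<in> X \<Longrightarrow>
     factor x (i - int M') (2 * M' + 1) = factor y (j - int M') (2 * M' + 1) \<Longrightarrow> \<phi>' x i = \<phi>' y j"
    using assms(2) unfolding block_map_def by blast
  define N where "N = M + M' + nat \<bar>d\<bar>"
  have "\<phi> x i = \<phi> y j \<and> \<phi>' x (i + d) = \<phi>' y (j + d)" if xy: "x \<in> X" "y \<in> X"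
    and eq: "factor x (i - int N) (2 * N + 1) = factor y (j - int N) (2 * N + 1)" for x y i j
  proof
    have "factor x (i - int N + (int N - int M)) (2 * M + 1) = factor y (j - int N + (int N - int M)) (2 * M + 1)"
      by (intro factor_sub[OF eq]) (auto simp: N_def)
    then show "\<phi> x i = \<phi> y j" by (intro M xy) simp
    have "factor x (i - int N + (int N - int M' + d)) (2 * M' + 1) = factor y (j - int N + (int N - int M' + d)) (2 * M' + 1)"
      by (intro factor_sub[OF eq]) (auto simp: N_def)
    then show "\<phi>' x (i + d) = \<phi>' y (j + d)" by (intro M' xy) (simp add: algebra_simps)
  qed
  then show ?thesis using that by blast
qed

lemma block_map_mono:
  assumes "block_map \<phi>" "x \<in> X" "y \<in> X" "x \<preceq> y"
  shows "\<phi> x \<preceq> \<phi> y"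
proof (rule orbit_leI)
  fix i n
  obtain N where N: "\<And>x y i j n. x \<in> X \<Longrightarrow> y \<in> X \<Longrightarrow>
    factor x (i - int N) (n + 2 * N) = factor y (j - int N) (n + 2 * N) \<Longrightarrow>
    factor (\<phi> x) i n = factor (\<phi> y) j n" by (rule block_map_factor[OF assms(1)]) blast
  obtain j where "factor x (i - int N) (n + 2 * N) = factor y j (n + 2 * N)"
    using assms(4) by (rule orbit_leD)
  then have "factor (\<phi> x) i n = factor (\<phi> y) (j + int N) n" by (intro N assms) simp
  then show "\<exists>j. factor (\<phi> x) i n = factor (\<phi> y) j n" by blast
qed

lemma block_map_recurrent:
  assumes "block_map \<phi>" "x \<in> X" "forward_recurrent x"
  shows "forward_recurrent (\<phi> x)"
  unfolding forward_recurrent_def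
proof (intro allI)
  fix i n m
  obtain N where N: "\<And>x y i j n. x \<in> X \<Longrightarrow> y \<in> X \<Longrightarrow>
    factor x (i - int N) (n + 2 * N) = factor y (j - int N) (n + 2 * N) \<Longrightarrow>
    factor (\<phi> x) i n = factor (\<phi> y) j n" by (rule block_map_factor[OF assms(1)]) blast
  obtain j where "j \<ge> m - int N" "factor x j (n + 2 * N) = factor x (i - int N) (n + 2 * N)"
    using assms(3) unfolding forward_recurrent_def by blast
  then have "j + int N \<ge> m" "factor (\<phi> x) (j + int N) n = factor (\<phi> x) i n"
    by (auto intro: N assms)
  then show "\<exists>j\<ge>m. factor (\<phi> x) j n = factor (\<phi> x) i n" by blast
qed

text \<open>At each coordinate the identity depends on one window of y, and that window also occurs
  in x, where the identity holds.\<close>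

lemma block_map_eq_shift:
  assumes "block_map \<phi>" "block_map \<phi>'" "x \<in> X" "y \<in> X" "y \<preceq> x"
    and eq: "\<phi> x = shift_power d (\<phi>' x)"
  shows "\<phi> y = shift_power d (\<phi>' y)"
proof
  fix i
  obtain N where N: "\<And>x y i j. x \<in> X \<Longrightarrow> y \<in> X \<Longrightarrow>
    factor x (i - int N) (2 * N + 1) = factor y (j - int N) (2 * N + 1) \<Longrightarrow>
    \<phi> x i = \<phi> y j \<and> \<phi>' x (i + d) = \<phi>' y (j + d)"
    by (rule block_map_pair[OF assms(1,2), of d]) blast
  obtain j where "factor y (i - int N) (2 * N + 1) = factor x j (2 * N + 1)"
    using assms(5) by (rule orbit_leD)
  then have "\<phi> y i = \<phi> x (j + int N) \<and> \<phi>' y (i + d) = \<phi>' x (j + int N + d)"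
    by (intro N assms) simp
  then show "\<phi> y i = shift_power d (\<phi>' y) i" by (simp add: eq shift_power_apply)
qed

text \<open>Every window of y recurs to the right of s, where the two sides are known to agree; so
  agreement of the futures already determines the orbit.\<close>

lemma block_map_eq_shift_recurrent:
  assumes "block_map \<phi>" "block_map \<phi>'" "y \<in> X" "forward_recurrent y"
    and eq: "\<And>i. i \<ge> s \<Longrightarrow> \<phi> y i = \<phi>' y (i + d)"
  shows "\<phi> y = shift_power d (\<phi>' y)"
proof
  fix i
  obtain N where N: "\<And>x y i j. x \<in> X \<Longrightarrow> y \<in> X \<Longrightarrow>
    factor x (i - int N) (2 * N + 1) = factor y (j - int N) (2 * N + 1) \<Longrightarrow>
    \<phi> x i = \<phi> y j \<and> \<phi>' x (i + d) = \<phi>' y (j + d)"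
    by (rule block_map_pair[OF assms(1,2), of d]) blast
  obtain j where j: "j \<ge> s" "factor y j (2 * N + 1) = factor y (i - int N) (2 * N + 1)"
    using assms(4) unfolding forward_recurrent_def by blast
  then have "\<phi> y i = \<phi> y (j + int N) \<and> \<phi>' y (i + d) = \<phi>' y (j + int N + d)"
    by (intro N assms) simp
  then show "\<phi> y i = shift_power d (\<phi>' y) i" using eq[of "j + int N"] j(1) by (simp add: shift_power_apply)
qed

section \<open>Action of automorphisms on orbit closures\<close>

lemma auto_mapE:
  assumes "auto_map \<phi>"
  obtains \<psi> where "block_map \<phi>" "block_map \<psi>" "\<And>x. x \<in> X \<Longrightarrow> \<psi> (\<phi> x) = x" "\<And>x. x \<in> X \<Longrightarrow> \<phi> (\<psi> x) = x"
  using assms unfolding auto_map_def by blast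

lemma auto_map_maximal:
  assumes "auto_map \<phi>" "maximal x" shows "maximal (\<phi> x)"
proof -
  obtain \<psi> where \<psi>: "block_map \<phi>" "block_map \<psi>" "\<And>x. x \<in> X \<Longrightarrow> \<psi> (\<phi> x) = x" "\<And>x. x \<in> X \<Longrightarrow> \<phi> (\<psi> x) = x"
    using auto_mapE[OF assms(1)] by blast
  have x: "x \<in> X" using assms(2) by (simp add: maximal_def)
  have "y \<preceq> \<phi> x" if y: "y \<in> X" "\<phi> x \<preceq> y" for y
  proof -
    have "\<psi> (\<phi> x) \<preceq> \<psi> y"
      by (rule block_map_mono[OF \<psi>(2) block_map_closed[OF \<psi>(1) x] y])
    then have "x \<preceq> \<psi> y" using \<psi>(3) x by simp
    then have "\<psi> y \<preceq> x" using assms(2) y \<psi>(2) block_map_closed unfolding maximal_def by blast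
    then have "\<phi> (\<psi> y) \<preceq> \<phi> x"
      by (rule block_map_mono[OF \<psi>(1) block_map_closed[OF \<psi>(2) y(1)] x])
    then show ?thesis using \<psi>(4) y by simp
  qed
  then show ?thesis using block_map_closed[OF \<psi>(1) x] by (simp add: maximal_def)
qed

lemma auto_map_recurrent:
  assumes "auto_map \<phi>" "x \<in> X" "forward_recurrent (\<phi> x)" shows "forward_recurrent x"
proof -
  obtain \<psi> where \<psi>: "block_map \<phi>" "block_map \<psi>" "\<And>x. x \<in> X \<Longrightarrow> \<psi> (\<phi> x) = x" "\<And>x. x \<in> X \<Longrightarrow> \<phi> (\<psi> x) = x"
    using auto_mapE[OF assms(1)] by blast
  have "forward_recurrent (\<psi> (\<phi> x))"
    by (rule block_map_recurrent[OF \<psi>(2) block_map_closed[OF \<psi>(1) assms(2)] assms(3)])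
  then show ?thesis using \<psi>(3) assms(2) by simp
qed

text \<open>The list covers the aperiodic points by maximality of its length. An uncovered y would
  have a central word absent from all entries, but by density this word occurs in an aperiodic
  point, which is covered.\<close>

lemma aperiodic_cover:
  obtains xs where "set xs \<subseteq> {x \<in> X. \<not> periodic x}" "orbit_independent xs" "length xs < k"
    "\<And>y. y \<in> X \<Longrightarrow> \<exists>x\<in>set xs. y \<preceq> x"
proof -
  let ?S = "{x \<in> X. \<not> periodic x}"
  have "\<exists>xs. set xs \<subseteq> ?S \<and> orbit_independent xs \<and> length xs < k \<and> (\<forall>y\<in>?S. \<exists>x\<in>set xs. y \<preceq> x)"
    by (rule independent_cover) (rule independent_length)
  then obtain xs where
    *: "set xs \<subseteq> ?S \<and> orbit_independent xs \<and> length xs < k \<and> (\<forall>y\<in>?S. \<exists>x\<in>set xs. y \<preceq> x)"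
    by (elim exE)
  note xs = conjunct1[OF *] conjunct1[OF conjunct2[OF *]] conjunct1[OF conjunct2[OF conjunct2[OF *]]]
    conjunct2[OF conjunct2[OF conjunct2[OF *]]]
  have "\<exists>x\<in>set xs. y \<preceq> x" if y: "y \<in> X" for y
  proof (rule ccontr)
    assume "\<not> ?thesis"
    then have "\<forall>\<^sub>F n in sequentially. \<forall>x\<in>set xs. factor y (- int n) (2 * n) \<notin> factors x (2 * n)"
      by (intro eventually_ball_finite ballI eventually_separated) auto
    then obtain n where n: "\<forall>x\<in>set xs. factor y (- int n) (2 * n) \<notin> factors x (2 * n)"
      unfolding eventually_sequentially by blast
    obtain z where z: "z \<in> X" "\<not> periodic z" "factor y (- int n) (2 * n) \<in> factors z (2 * n)"
      using aperiodic_dense[OF y] by blast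
    then obtain x where "x \<in> set xs" "z \<preceq> x" using xs(4) by blast
    then show False using n z(3) unfolding orbit_le_def by blast
  qed
  then show ?thesis using xs by (intro that)
qed

lemma maximal_cover:
  obtains M where "finite M" "\<And>x. x \<in> M \<Longrightarrow> maximal x \<and> \<not> periodic x" "\<And>y. y \<in> X \<Longrightarrow> \<exists>x\<in>M. y \<preceq> x"
proof -
  obtain xs where xs: "set xs \<subseteq> {x \<in> X. \<not> periodic x}" "orbit_independent xs"
    and cover: "\<And>y. y \<in> X \<Longrightarrow> \<exists>x\<in>set xs. y \<preceq> x"
    by (rule aperiodic_cover) blast
  let ?M = "{x \<in> set xs. maximal x}"
  have "\<exists>x\<in>?M. y \<preceq> x" if y: "y \<in> X" for y
  proof -
    let ?I = "{j. j < length xs \<and> y \<preceq> xs ! j}"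
    have I: "finite ?I" "?I \<noteq> {}" using cover[OF y] by (auto simp: in_set_conv_nth)
    \<comment> \<open>The last entry above y is maximal: a point above it lies below some entry l,
      which is again above y, so l is at most j, and independence of the list excludes l <
      j.\<close>
    define j where "j = Max ?I"
    have j: "j < length xs" "y \<preceq> xs ! j" using Max_in[OF I] by (simp_all add: j_def)
    have jX: "xs ! j \<in> X" using j xs(1) nth_mem by blast
    have "z \<preceq> xs ! j" if z: "z \<in> X" "xs ! j \<preceq> z" for z
    proof -
      obtain l where l: "l < length xs" "z \<preceq> xs ! l" using cover[OF z(1)] by (metis in_set_conv_nth)
      have jl: "xs ! j \<preceq> xs ! l" using z l orbit_le_trans by blast
      then have "l \<in> ?I" using j l orbit_le_trans by blast
      then have "l \<le> j" using I by (simp add: j_def)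
      moreover have "\<not> l < j"
        using xs(2) jl j(1) unfolding sorted_wrt_iff_nth_less by blast
      ultimately show ?thesis using l by simp
    qed
    then have "maximal (xs ! j)" using jX by (simp add: maximal_def)
    then have "xs ! j \<in> ?M" using j(1) by simp
    with j(2) show ?thesis by blast
  qed
  then show ?thesis using xs(1) by (intro that[of ?M]) auto
qed

text \<open>Maximality makes y generate the same closure as some x in M, so the separating word
  chosen for x serves y as well; only finitely many words are involved.\<close>

lemma finite_nonrecurrent_orbits:
  "finite (shift_orbit ` {y. maximal y \<and> \<not> forward_recurrent y})"
proof -
  obtain M where M: "finite M" "\<And>x. x \<in> M \<Longrightarrow> maximal x \<and> \<not> periodic x" "\<And>y. y \<in> X \<Longrightarrow> \<exists>x\<in>M. y \<preceq> x"
    by (rule maximal_cover) blast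
  define L where "L u = {y \<in> X. factor y 0 (length u) = u \<and> (\<forall>i>0. factor y i (length u) \<noteq> u)}" for u
  have "\<exists>u. u \<in> factors x (length u) \<and> (\<forall>y. y \<in> X \<longrightarrow> y \<preceq> x \<longrightarrow> u \<in> factors y (length u) \<longrightarrow> x \<preceq> y)"
    if "x \<in> M" for x
    using separating_factor[of x] M(2)[OF that] unfolding maximal_def by metis
  then obtain U where U: "\<And>x. x \<in> M \<Longrightarrow> U x \<in> factors x (length (U x))"
    "\<And>x y. x \<in> M \<Longrightarrow> y \<in> X \<Longrightarrow> y \<preceq> x \<Longrightarrow> U x \<in> factors y (length (U x)) \<Longrightarrow> x \<preceq> y" by metis
  have "shift_orbit y \<in> shift_orbit ` (\<Union>x\<in>M. L (U x))" if y: "maximal y" "\<not> forward_recurrent y" for y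
  proof -
    have yX: "y \<in> X" using y by (simp add: maximal_def)
    then obtain x where x: "x \<in> M" "y \<preceq> x" using M(3) by blast
    have xX: "x \<in> X" using M(2)[OF x(1)] by (simp add: maximal_def)
    have "x \<preceq> y" using y(1) x xX by (simp add: maximal_def)
    obtain s where "factor (shift_power s y) 0 (length (U x)) = U x"
      "\<And>i. i > 0 \<Longrightarrow> factor (shift_power s y) i (length (U x)) \<noteq> U x"
      using last_occurrence[OF xX U(1)[OF x(1)] U(2)[OF x(1)] yX x(2) \<open>x \<preceq> y\<close> y(2)] by metis
    then have "shift_power s y \<in> L (U x)" using shift_closed[OF yX] by (simp add: L_def)
    then show ?thesis using x(1) shift_orbit_shift_power by (metis UN_I imageI)
  qed
  then have "shift_orbit ` {y. maximal y \<and> \<not> forward_recurrent y} \<subseteq> shift_orbit ` (\<Union>x\<in>M. L (U x))"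
    by blast
  moreover have "finite (\<Union>x\<in>M. L (U x))"
    unfolding L_def using M(1) finite_last_occurrence by blast
  ultimately show ?thesis using finite_subset finite_imageI by blast
qed

lemma finite_auto_orbits:
  assumes x: "maximal x" "\<not> periodic x"
  obtains y where "y \<in> X" "x \<preceq> y" "finite ((\<lambda>\<phi>. shift_orbit (\<phi> y)) ` Collect auto_map)"
proof (cases "\<forall>y\<in>X. y \<preceq> x \<and> x \<preceq> y \<longrightarrow> forward_recurrent y")
  case False
  then obtain y where y: "y \<in> X" "y \<preceq> x" "x \<preceq> y" "\<not> forward_recurrent y" by blast
  have "maximal y" using x(1) y orbit_le_trans unfolding maximal_def by blast
  then have "(\<lambda>\<phi>. shift_orbit (\<phi> y)) ` Collect auto_map \<subseteq>
      shift_orbit ` {y. maximal y \<and> \<not> forward_recurrent y}"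
    using auto_map_maximal auto_map_recurrent y by blast
  then show ?thesis using that y finite_nonrecurrent_orbits finite_subset by blast
next
  case True
  have xX: "x \<in> X" using x by (simp add: maximal_def)
  obtain y z where yz: "y \<in> X" "z \<in> X" "y \<preceq> x" "y \<noteq> z" "\<And>i. i \<ge> 0 \<Longrightarrow> y i = z i"
    by (rule asymptotic_pair[OF xX x(2)]) blast
  \<comment> \<open>The asymptotic pair is only known to arise inside the closure of x; minimality
    makes the orbit of y dense there.\<close>
  have xy: "x \<preceq> y" using recurrent_minimal[OF xX x(2) _ yz(1,3)] True by blast
  have rec: "forward_recurrent y" using True xy yz by blast
  have "\<exists>s. (\<lambda>n. \<phi> y (s + int n)) \<in> special_futures" if \<phi>: "auto_map \<phi>" for \<phi>
  proof -
    obtain \<psi> where \<psi>: "block_map \<phi>" "block_map \<psi>" "\<And>x. x \<in> X \<Longrightarrow> \<psi> (\<phi> x) = x" "\<And>x. x \<in> X \<Longrightarrow> \<phi> (\<psi> x) = x"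
      using auto_mapE[OF \<phi>] by blast
    have ne: "\<phi> y \<noteq> \<phi> z" using \<psi>(3) yz by metis
    obtain N where N: "\<And>x y i j. x \<in> X \<Longrightarrow> y \<in> X \<Longrightarrow>
      factor x (i - int N) (2 * N + 1) = factor y (j - int N) (2 * N + 1) \<Longrightarrow>
      \<phi> x i = \<phi> y j \<and> \<phi> x (i + 0) = \<phi> y (j + 0)"
      by (rule block_map_pair[OF \<psi>(1,1), of 0]) blast
    have agree: "\<phi> y i = \<phi> z i" if "i \<ge> int N" for i
    proof -
      have "factor y (i - int N) (2 * N + 1) = factor z (i - int N) (2 * N + 1)"
        unfolding factor_eq_iff using that yz(5) by auto
      from N[OF yz(1,2) this] show ?thesis by simp
    qed
    obtain i0 where i0: "\<phi> y i0 \<noteq> \<phi> z i0" using ne by auto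
    have "j \<le> int N" if "\<phi> y j \<noteq> \<phi> z j" for j using agree[of j] that by linarith
    from int_greatest[of "\<lambda>j. \<phi> y j \<noteq> \<phi> z j", OF i0 this]
    obtain t where t: "\<phi> y t \<noteq> \<phi> z t" "\<And>j. j > t \<Longrightarrow> \<phi> y j = \<phi> z j" by blast
    have "(\<lambda>n. \<phi> y (t + 1 + int n)) \<in> special_futures"
      by (rule special_futureI[of _ "\<phi> z"])
        (use t block_map_closed[OF \<psi>(1) yz(1)] block_map_closed[OF \<psi>(1) yz(2)] in auto)
    then show ?thesis by blast
  qed
  then obtain s where s: "\<And>\<phi>. auto_map \<phi> \<Longrightarrow> (\<lambda>n. \<phi> y (s \<phi> + int n)) \<in> special_futures" by metis
  \<comment> \<open>Equal values of c mean that the images of y have equal futures up to a shift,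
    hence the same orbit since y is forward recurrent. As c takes values in a finite set, there are
    finitely many orbits.\<close>
  define c where "c \<phi> = (\<lambda>n. \<phi> y (s \<phi> + int n))" for \<phi>
  have same: "shift_orbit (\<phi> y) = shift_orbit (\<phi>' y)"
    if \<phi>: "auto_map \<phi>" "auto_map \<phi>'" "c \<phi> = c \<phi>'" for \<phi> \<phi>'
  proof -
    have "\<phi> y i = \<phi>' y (i + (s \<phi>' - s \<phi>))" if "i \<ge> s \<phi>" for i
      using fun_cong[OF \<phi>(3), of "nat (i - s \<phi>)"] that by (simp add: c_def algebra_simps)
    then have "\<phi> y = shift_power (s \<phi>' - s \<phi>) (\<phi>' y)"
      using \<phi> yz(1) rec by (intro block_map_eq_shift_recurrent[where s = "s \<phi>"]) (auto simp: auto_map_def)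
    then show ?thesis by (simp add: shift_orbit_shift_power)
  qed
  have "c ` Collect auto_map \<subseteq> special_futures" using s by (auto simp: c_def)
  then have "finite (c ` Collect auto_map)" using finite_special_futures by (rule finite_subset)
  then have "finite ((\<lambda>\<phi>. shift_orbit (\<phi> y)) ` Collect auto_map)"
    by (rule finite_image_factor) (use same in blast)
  then show ?thesis using that yz(1) xy by blast
qed

lemma finite_auto_classes:
  obtains Y where "finite Y" "Y \<subseteq> X" "\<And>x. x \<in> X \<Longrightarrow> \<exists>y\<in>Y. x \<preceq> y"
    "\<And>y. y \<in> Y \<Longrightarrow> finite ((\<lambda>\<phi>. shift_orbit (\<phi> y)) ` Collect auto_map)"
proof -
  obtain M where M: "finite M" "\<And>x. x \<in> M \<Longrightarrow> maximal x \<and> \<not> periodic x" "\<And>y. y \<in> X \<Longrightarrow> \<exists>x\<in>M. y \<preceq> x"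
    by (rule maximal_cover) blast
  have "\<exists>y. y \<in> X \<and> x \<preceq> y \<and> finite ((\<lambda>\<phi>. shift_orbit (\<phi> y)) ` Collect auto_map)" if "x \<in> M" for x
    using finite_auto_orbits[of x] M(2)[OF that] by metis
  then obtain f where f: "\<And>x. x \<in> M \<Longrightarrow> f x \<in> X \<and> x \<preceq> f x \<and>
      finite ((\<lambda>\<phi>. shift_orbit (\<phi> (f x))) ` Collect auto_map)" by metis
  show ?thesis
  proof (rule that[of "f ` M"])
    fix x assume "x \<in> X"
    then obtain m where "m \<in> M" "x \<preceq> m" using M(3) by blast
    then show "\<exists>y\<in>f ` M. x \<preceq> y" using f orbit_le_trans by blast
  qed (use M(1) f in auto)
qed

end

subsection \<open>Subgroups of lattices\<close>

text \<open>Induction on the number of jointly injective homomorphisms to the integers. The kernel K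
  of the last one is a lattice, and its image, if nonzero, is infinite cyclic; a preimage b of a
  generator splits G into K and the powers of b.\<close>

lemma embedded_in_lattice:
  fixes G :: "('b, 'm) monoid_scheme" and f :: "nat \<Rightarrow> 'b \<Rightarrow> int"
  assumes "group G" and "\<And>i. i < m \<Longrightarrow> f i \<in> hom G integer_group"
    and "\<And>x. x \<in> carrier G \<Longrightarrow> (\<And>i. i < m \<Longrightarrow> f i x = 0) \<Longrightarrow> x = \<one>\<^bsub>G\<^esub>"
  shows "\<exists>d\<le>m. G \<cong> integer_lattice_group d"
  using assms
proof (induction m arbitrary: G)
  case 0
  interpret group G by fact
  have "carrier G = {\<one>\<^bsub>G\<^esub>}" using "0.prems"(3) one_closed by blast
  then have "(\<lambda>x. \<lambda>i\<in>{..<0::nat}. 0::int) \<in> iso G (integer_lattice_group 0)"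
    by (auto simp: iso_def hom_def bij_betw_def integer_lattice_group_def)
  then show ?case by (auto simp: is_iso_def)
next
  case (Suc m)
  interpret group G by fact
  have hom: "f i (x \<otimes>\<^bsub>G\<^esub> y) = f i x + f i y" if "i < Suc m" "x \<in> carrier G" "y \<in> carrier G" for i x y
    using Suc.prems(2)[OF that(1)] that(2,3) by (simp add: hom_def)
  have hom_one: "f i \<one>\<^bsub>G\<^esub> = 0" if "i < Suc m" for i
    using hom[OF that, of "\<one>\<^bsub>G\<^esub>" "\<one>\<^bsub>G\<^esub>"] by simp
  have hom_inv: "f i (inv\<^bsub>G\<^esub> x) = - f i x" if "i < Suc m" "x \<in> carrier G" for i x
    using hom[OF that(1), of x "inv\<^bsub>G\<^esub> x"] that hom_one by simp
  have hom_pow: "f i (x [^]\<^bsub>G\<^esub> (n::int)) = n * f i x" if "i < Suc m" "x \<in> carrier G" for i x n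
    using hom_int_pow[OF Suc.prems(2)[OF that(1)] that(2)] group_axioms by simp
  have comm: "x \<otimes>\<^bsub>G\<^esub> y = y \<otimes>\<^bsub>G\<^esub> x" if xy: "x \<in> carrier G" "y \<in> carrier G" for x y
  proof -
    \<comment> \<open>All the homomorphisms vanish on this commutator expression, so commutativity
      follows from joint injectivity.\<close>
    have "x \<otimes>\<^bsub>G\<^esub> y \<otimes>\<^bsub>G\<^esub> inv\<^bsub>G\<^esub> (y \<otimes>\<^bsub>G\<^esub> x) = \<one>\<^bsub>G\<^esub>"
      using xy by (intro Suc.prems(3)) (simp_all add: hom hom_inv)
    then show ?thesis using xy by (metis inv_closed inv_equality inv_inv m_closed)
  qed
  interpret comm_group G using comm by (intro group_comm_groupI)
  define K where "K = {x \<in> carrier G. f m x = 0}"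
  have KG: "K \<subseteq> carrier G" by (auto simp: K_def)
  have subK: "subgroup K G"
    by (rule subgroupI) (auto simp: K_def hom hom_inv hom_one intro!: exI[of _ "\<one>\<^bsub>G\<^esub>"])
  have grK: "group (G\<lparr>carrier := K\<rparr>)" using subK by (rule subgroup_imp_group)
  have "\<exists>d\<le>m. G\<lparr>carrier := K\<rparr> \<cong> integer_lattice_group d"
  proof (rule Suc.IH[OF grK])
    fix i assume "i < m"
    then show "f i \<in> hom (G\<lparr>carrier := K\<rparr>) integer_group"
      using Suc.prems(2)[of i] KG by (auto simp: hom_def)
  next
    fix x assume x: "x \<in> carrier (G\<lparr>carrier := K\<rparr>)" and "\<And>i. i < m \<Longrightarrow> f i x = 0"
    then have "f i x = 0" if "i < Suc m" for i using that by (auto simp: K_def less_Suc_eq)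
    then show "x = \<one>\<^bsub>G\<lparr>carrier := K\<rparr>\<^esub>" using x KG Suc.prems(3) by auto
  qed
  then obtain d where d: "d \<le> m" "G\<lparr>carrier := K\<rparr> \<cong> integer_lattice_group d" by blast
  show ?case
  proof (cases "K = carrier G")
    case True
    then show ?thesis using d by (auto intro!: exI[of _ d])
  next
    case False
    then obtain b0 where b0: "b0 \<in> carrier G" "f m b0 \<noteq> 0" by (auto simp: K_def)
    define P where "P n \<longleftrightarrow> n > 0 \<and> (\<exists>b\<in>carrier G. f m b = int n)" for n :: nat
    have "\<exists>n. P n"
    proof (cases "f m b0 > 0")
      case True
      then show ?thesis using b0 unfolding P_def by (intro exI[of _ "nat (f m b0)"]) auto
    next
      case False
      then have "f m (inv\<^bsub>G\<^esub> b0) = int (nat (- f m b0))" using b0 hom_inv by simp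
      then show ?thesis using b0 False unfolding P_def by (intro exI[of _ "nat (- f m b0)"]) auto
    qed
    \<comment> \<open>g is the least positive value of f m, hence the generator of its image: a
      nonzero remainder modulo g would be a smaller positive value.\<close>
    define g where "g = (LEAST n. P n)"
    have "P g" unfolding g_def using \<open>\<exists>n. P n\<close> by (rule LeastI_ex)
    then obtain b where b: "b \<in> carrier G" "f m b = int g" and g: "g > 0" by (auto simp: P_def)
    have dvd: "f m x = (f m x div int g) * int g" if x: "x \<in> carrier G" for x
    proof (rule ccontr)
      assume ne: "f m x \<noteq> (f m x div int g) * int g"
      let ?y = "x \<otimes>\<^bsub>G\<^esub> b [^]\<^bsub>G\<^esub> (- (f m x div int g))"
      have "f m ?y = f m x - (f m x div int g) * int g"
        using x b by (simp add: hom hom_pow del: int_pow_neg)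
      also have "\<dots> = f m x mod int g" by (simp add: minus_div_mult_eq_mod)
      finally have fy: "f m ?y = f m x mod int g" .
      have "f m x mod int g \<noteq> 0" using ne by (metis add.right_neutral div_mult_mod_eq)
      moreover have "f m x mod int g \<ge> 0" "f m x mod int g < int g" using g by auto
      ultimately have "P (nat (f m x mod int g))" "nat (f m x mod int g) < g"
        using fy x b unfolding P_def by (auto intro!: bexI[of _ ?y])
      then show False using not_less_Least unfolding g_def by blast
    qed
    let ?Z = "integer_lattice_group"
    have grZ: "group (?Z n)" for n by (simp add: integer_lattice_group_def)
    have "?Z d \<cong> G\<lparr>carrier := K\<rparr>" using group.iso_sym[OF grK d(2)] .
    then obtain h where h: "h \<in> iso (?Z d) (G\<lparr>carrier := K\<rparr>)" by (auto simp: is_iso_def)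
    have hK: "h v \<in> K" if "v \<in> carrier (?Z d)" for v using h that by (auto simp: iso_def hom_def)
    have hmult: "h (v \<otimes>\<^bsub>?Z d\<^esub> w) = h v \<otimes>\<^bsub>G\<^esub> h w"
      if "v \<in> carrier (?Z d)" "w \<in> carrier (?Z d)" for v w
      using h that by (auto simp: iso_def hom_def)
    have hinj: "inj_on h (carrier (?Z d))" and hsurj: "h ` carrier (?Z d) = K"
      using h by (auto simp: iso_def bij_betw_def)
    define r where "r v = restrict v {..<d}" for v :: "nat \<Rightarrow> int"
    have rZ: "r v \<in> carrier (?Z d)" for v by (auto simp: r_def integer_lattice_group_def)
    have rm: "r (v \<otimes>\<^bsub>?Z (Suc d)\<^esub> w) = r v \<otimes>\<^bsub>?Z d\<^esub> r w" for v w
      by (auto simp: r_def integer_lattice_group_def fun_eq_iff)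
    \<comment> \<open>The first d coordinates describe the part in K, and the new coordinate v d is
      the exponent of b.\<close>
    define H where "H v = h (r v) \<otimes>\<^bsub>G\<^esub> b [^]\<^bsub>G\<^esub> (v d)" for v
    have hG: "h (r v) \<in> carrier G" and fh: "f m (h (r v)) = 0" for v
      using hK[OF rZ] by (auto simp: K_def)
    have fH: "f m (H v) = v d * int g" for v
      using hG b by (simp add: H_def hom hom_pow fh)
    have HG: "H v \<in> carrier G" for v using hG b by (simp add: H_def)
    have "H \<in> hom (?Z (Suc d)) G"
    proof (rule homI)
      fix v w
      have vw: "(v \<otimes>\<^bsub>?Z (Suc d)\<^esub> w) d = v d + w d" by (simp add: integer_lattice_group_def)
      have "H (v \<otimes>\<^bsub>?Z (Suc d)\<^esub> w) = (h (r v) \<otimes>\<^bsub>G\<^esub> h (r w)) \<otimes>\<^bsub>G\<^esub> (b [^]\<^bsub>G\<^esub> (v d) \<otimes>\<^bsub>G\<^esub> b [^]\<^bsub>G\<^esub> (w d))"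
        unfolding H_def vw rm using b by (simp add: hmult rZ int_pow_mult)
      also have "\<dots> = H v \<otimes>\<^bsub>G\<^esub> H w"
        unfolding H_def using hG b by (simp add: m_ac)
      finally show "H (v \<otimes>\<^bsub>?Z (Suc d)\<^esub> w) = H v \<otimes>\<^bsub>G\<^esub> H w" .
    qed (rule HG)
    moreover have "inj_on H (carrier (?Z (Suc d)))"
    proof (rule inj_onI)
      fix v w assume v: "v \<in> carrier (?Z (Suc d))" and w: "w \<in> carrier (?Z (Suc d))" and eq: "H v = H w"
      have "v d = w d" using fH[of v] fH[of w] eq g by simp
      then have "h (r v) = h (r w)"
        using eq hG b unfolding H_def by (metis int_pow_closed right_cancel)
      then have "r v = r w" using hinj rZ by (auto dest: inj_onD)
      then have "v i = w i" if "i < d" for i using that by (metis r_def restrict_apply lessThan_iff)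
      with \<open>v d = w d\<close> have "v i = w i" if "i < Suc d" for i using that by (metis less_SucE)
      moreover have "v i = w i" if "\<not> i < Suc d" for i
        using v w that by (auto simp: integer_lattice_group_def PiE_def extensional_def)
      ultimately show "v = w" by blast
    qed
    moreover have "H ` carrier (?Z (Suc d)) = carrier G"
    proof
      show "carrier G \<subseteq> H ` carrier (?Z (Suc d))"
      proof
        fix x assume x: "x \<in> carrier G"
        define q where "q = f m x div int g"
        have "f m (x \<otimes>\<^bsub>G\<^esub> b [^]\<^bsub>G\<^esub> (- q)) = 0"
          using x b dvd[OF x] by (simp add: hom hom_pow q_def del: int_pow_neg)
        then have "x \<otimes>\<^bsub>G\<^esub> b [^]\<^bsub>G\<^esub> (- q) \<in> K" using x b by (simp add: K_def)
        then obtain w where w: "w \<in> carrier (?Z d)" "h w = x \<otimes>\<^bsub>G\<^esub> b [^]\<^bsub>G\<^esub> (- q)" using hsurj by (metis imageE)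
        define v where "v = w(d := q)"
        have "v \<in> carrier (?Z (Suc d))"
          using w(1) by (auto simp: v_def integer_lattice_group_def PiE_def extensional_def)
        moreover have "r v = w"
          using w(1) by (auto simp: v_def r_def integer_lattice_group_def fun_eq_iff PiE_def extensional_def)
        then have "H v = x"
          using w(2) x b by (simp add: H_def v_def m_assoc int_pow_mult[symmetric])
        ultimately show "x \<in> H ` carrier (?Z (Suc d))" by blast
      qed
    qed (use HG in blast)
    ultimately have "H \<in> iso (?Z (Suc d)) G" by (simp add: iso_def bij_betw_def)
    then have "?Z (Suc d) \<cong> G" by (auto simp: is_iso_def)
    then have "G \<cong> ?Z (Suc d)" by (rule group.iso_sym[OF grZ])
    then show ?thesis using d(1) by (intro exI[of _ "Suc d"]) simp
  qed
qed

subsection \<open>Topology of the shift space\<close>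

lemma topspace_full_shift: "topspace (full_shift A) = {x. \<forall>i. x i \<in> A}"
  by (auto simp: full_shift_def PiE_def Pi_def)

lemma openin_cylinder:
  assumes "finite I"
  shows "openin (full_shift A) {z. (\<forall>i. z i \<in> A) \<and> (\<forall>i\<in>I. z i = y i)}"
proof -
  define U where "U i = (if i \<in> I then {y i} \<inter> A else A)" for i
  have "openin (full_shift A) (\<Pi>\<^sub>E i\<in>UNIV. U i)"
    unfolding full_shift_def
  proof (rule product_topology_basis)
    show "finite {i. U i \<noteq> topspace (discrete_topology A)}"
      by (rule finite_subset[OF _ assms]) (auto simp: U_def)
  qed (auto simp: U_def)
  moreover have "(\<Pi>\<^sub>E i\<in>UNIV. U i) = {z. (\<forall>i. z i \<in> A) \<and> (\<forall>i\<in>I. z i = y i)}"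
    by (auto simp: U_def PiE_def Pi_def split: if_splits)
  ultimately show ?thesis by simp
qed

lemma open_contains_cylinder:
  assumes "openin (full_shift A) U" "x \<in> U"
  obtains N :: nat where "\<And>z. (\<And>i. z i \<in> A) \<Longrightarrow> (\<And>i. \<bar>i\<bar> \<le> int N \<Longrightarrow> z i = x i) \<Longrightarrow> z \<in> U"
proof -
  obtain V where V: "finite {i. V i \<noteq> A}" "x \<in> Pi\<^sub>E UNIV V" "Pi\<^sub>E UNIV V \<subseteq> U"
    using assms unfolding full_shift_def openin_product_topology_alt by fastforce
  obtain N where N: "\<And>i. i \<in> (\<lambda>i. nat \<bar>i\<bar>) ` {i. V i \<noteq> A} \<Longrightarrow> i \<le> N"
    using V(1) finite_nat_set_iff_bounded_le by (metis finite_imageI)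
  have "z \<in> U" if z: "\<And>i. z i \<in> A" "\<And>i. \<bar>i\<bar> \<le> int N \<Longrightarrow> z i = x i" for z
  proof -
    have "z i \<in> V i" for i
    proof (cases "V i = A")
      case False
      then have "nat \<bar>i\<bar> \<le> N" by (intro N) auto
      then have "z i = x i" using z(2)[of i] by auto
      then show ?thesis using V(2) by (auto simp: PiE_def Pi_def)
    qed (use z in simp)
    then show ?thesis using V(3) by (auto simp: PiE_def Pi_def)
  qed
  then show ?thesis using that by blast
qed

lemma is_shift_in_alphabet: "is_shift A X \<Longrightarrow> x \<in> X \<Longrightarrow> x i \<in> A"
  using closedin_subset[of "full_shift A" X] by (auto simp: is_shift_def topspace_full_shift)

lemma is_shift_shift_power:
  assumes "is_shift A X" "x \<in> X" shows "shift_power s x \<in> X"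
proof (induction s rule: int_induct_both[of _ 0])
  case 1
  then show ?case using assms(2) by (simp add: shift_power_def)
next
  case (2 s)
  have "shift_power (s + 1) x = shift_map (shift_power s x)"
    by (simp add: fun_eq_iff shift_power_apply shift_map_def algebra_simps)
  then show ?case using 2 assms(1) by (auto simp: is_shift_def)
next
  case (3 s)
  \<comment> \<open>Surjectivity of the shift on X supplies a preimage inside X, and it can only be
    the backward shift.\<close>
  then obtain y where y: "y \<in> X" "shift_power s x = shift_map y" using assms(1) by (force simp: is_shift_def)
  have "y = shift_power (s - 1) x"
  proof
    fix i
    show "y i = shift_power (s - 1) x i"
      using fun_cong[OF y(2), of "i - 1"] by (simp add: shift_power_apply shift_map_def algebra_simps)
  qed
  then show ?case using y by simp
qed

lemma is_shift_subseq_limit: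
  assumes "finite A" "is_shift A X" and f: "\<And>n :: nat. f n \<in> X"
  shows "\<exists>y\<in>X. \<exists>r. strict_mono r \<and> (\<forall>n::nat. \<forall>i. \<bar>i\<bar> \<le> int n \<longrightarrow> f (r n) i = y i)"
proof -
  let ?T = "full_shift A"
  have "compact_space ?T"
    unfolding full_shift_def compact_space_product_topology
    using assms(1) by (simp add: compact_space_discrete_topology)
  have top: "f n \<in> topspace ?T" for n
    using f is_shift_in_alphabet[OF assms(2)] by (simp add: topspace_full_shift)
  \<comment> \<open>A point common to the closures of all tails is a cluster point of the
    sequence.\<close>
  have "(\<Inter>n. ?T closure_of (f ` {n..})) \<noteq> {}"
  proof (rule compact_space_imp_nest[OF \<open>compact_space ?T\<close>])
    fix n
    have "f ` {n..} \<subseteq> ?T closure_of (f ` {n..})" using top by (intro closure_of_subset) auto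
    then show "?T closure_of (f ` {n..}) \<noteq> {}" by auto
  next
    show "decseq (\<lambda>n. ?T closure_of (f ` {n..}))"
      unfolding decseq_def by (intro allI impI closure_of_mono image_mono) simp
  qed simp
  then obtain y where y: "\<And>n. y \<in> ?T closure_of (f ` {n..})" by blast
  have "?T closure_of (f ` {0..}) \<subseteq> X"
    using f assms(2) by (intro closure_of_minimal) (auto simp: is_shift_def)
  then have yX: "y \<in> X" using y by blast
  have "\<exists>m\<ge>n. \<forall>i. \<bar>i\<bar> \<le> int N \<longrightarrow> f m i = y i" for n N
  proof -
    let ?U = "{z. (\<forall>i. z i \<in> A) \<and> (\<forall>i\<in>{- int N..int N}. z i = y i)}"
    have "y \<in> ?U \<and> openin ?T ?U"
      using is_shift_in_alphabet[OF assms(2) yX] openin_cylinder[of "{- int N..int N}" A y] by simp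
    from y[of n, unfolded in_closure_of, THEN conjunct2, rule_format, OF this]
    obtain z where "z \<in> f ` {n..}" and z: "z \<in> ?U" by (elim exE conjE)
    then obtain m where m: "m \<ge> n" "z = f m" by auto
    have "f m i = y i" if "\<bar>i\<bar> \<le> int N" for i
    proof -
      have "i \<in> {- int N..int N}" using that by auto
      with z m(2) show ?thesis by blast
    qed
    with m(1) show ?thesis by blast
  qed
  then obtain g where g: "\<And>n N. g n N \<ge> n" "\<And>n N i. \<bar>i\<bar> \<le> int N \<Longrightarrow> f (g n N) i = y i" by metis
  \<comment> \<open>The first argument of g is a lower bound for the index and the second is the
    radius of agreement: each new index exceeds the previous one, and the n-th has radius n.\<close>
  define r where "r = rec_nat (g 0 0) (\<lambda>n m. g (Suc m) (Suc n))"
  have r: "r 0 = g 0 0" "\<And>n. r (Suc n) = g (Suc (r n)) (Suc n)" by (simp_all add: r_def)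
  have "strict_mono r" unfolding strict_mono_Suc_iff using r(2) g(1) by (metis Suc_le_lessD)
  moreover have "f (r n) i = y i" if "\<bar>i\<bar> \<le> int n" for n i
    using that g(2) r by (cases n) simp_all
  ultimately show ?thesis using yX by blast
qed

text \<open>Shift invariance of X moves a word at any position to position 0, where
  \<open>complexity\<close> reads it.\<close>

lemma complexity_factors:
  assumes "is_shift A X"
  shows "complexity A X n = card (\<Union>x\<in>X. factors x n)"
proof -
  have w: "length w = n \<and> (\<forall>i<n. x (int i) = w ! i) \<longleftrightarrow> w = factor x 0 n" for w and x :: "int \<Rightarrow> 'a"
    by (auto simp: factor_def intro!: nth_equalityI)
  have "set (factor x 0 n) \<subseteq> A" if "x \<in> X" for x
    using is_shift_in_alphabet[OF assms that] by (auto simp: factor_def)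
  then have "{w. length w = n \<and> set w \<subseteq> A \<and> (\<exists>x\<in>X. \<forall>i<n. x (int i) = w ! i)} = (\<lambda>x. factor x 0 n) ` X"
    using w by blast
  also have "\<dots> = (\<Union>x\<in>X. factors x n)"
  proof
    show "(\<Union>x\<in>X. factors x n) \<subseteq> (\<lambda>x. factor x 0 n) ` X"
    proof
      fix w assume "w \<in> (\<Union>x\<in>X. factors x n)"
      then obtain x i where "x \<in> X" "w = factor x i n" by (auto simp: factors_def)
      then show "w \<in> (\<lambda>x. factor x 0 n) ` X"
        using is_shift_shift_power[OF assms, of x i]
        by (intro image_eqI[of _ _ "shift_power i x"]) (simp_all add: factor_shift_power)
    qed
  qed (auto simp: factors_def)
  finally show ?thesis by (simp add: complexity_def)
qed

lemma limsup_linear_growth: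
  fixes P :: "nat \<Rightarrow> nat"
  assumes "limsup (\<lambda>n. ereal (real (P n) / real n)) < ereal (real k)"
  shows "\<forall>\<^sub>F n in sequentially. P n + C < k * n"
proof -
  obtain c where c: "limsup (\<lambda>n. ereal (real (P n) / real n)) < ereal c" "ereal c < ereal (real k)"
    using ereal_dense2[OF assms] by blast
  have "\<forall>\<^sub>F n in sequentially. ereal (real (P n) / real n) < ereal c"
    using c(1) by (rule Limsup_lessD)
  \<comment> \<open>From this length on the slack (k - c) n is at least C; the summand 1 makes n
    positive, so that the quotient P n / n can be cleared.\<close>
  moreover have "\<forall>\<^sub>F n in sequentially. n \<ge> 1 + nat \<lceil>real C / (real k - c)\<rceil>"
    by (rule eventually_ge_at_top)
  ultimately show ?thesis
  proof eventually_elim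
    case (elim n)
    have kc: "real k - c > 0" using c by simp
    have "real C / (real k - c) \<le> real n" using elim(2) by linarith
    then have "real C \<le> (real k - c) * real n" using kc by (simp add: field_simps)
    moreover have "real (P n) < c * real n" using elim by (simp add: field_simps)
    ultimately have "real (P n + C) < real (k * n)" by (simp add: algebra_simps)
    then show ?case by linarith
  qed
qed

lemma dense_aperiodic_factor:
  assumes "is_shift A X" "shift_topology A X closure_of {x \<in> X. \<not> periodic x} = X" "x \<in> X"
  shows "\<exists>y\<in>X. \<not> periodic y \<and> factor x i n \<in> factors y n"
proof -
  let ?U = "{z. (\<forall>i. z i \<in> A) \<and> (\<forall>j\<in>{i..i + int n}. z j = x j)}"
  have x: "x \<in> shift_topology A X closure_of {x \<in> X. \<not> periodic x}" using assms by simp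
  have "openin (shift_topology A X) (?U \<inter> X)"
    unfolding shift_topology_def openin_subtopology using openin_cylinder[of "{i..i + int n}" A x] by blast
  then have "x \<in> ?U \<inter> X \<and> openin (shift_topology A X) (?U \<inter> X)"
    using assms(3) is_shift_in_alphabet[OF assms(1,3)] by simp
  from x[unfolded in_closure_of, THEN conjunct2, rule_format, OF this]
  obtain y where "y \<in> {x \<in> X. \<not> periodic x}" "y \<in> ?U \<inter> X" by (elim exE conjE)
  then have y: "y \<in> X" "\<not> periodic y" "\<forall>j\<in>{i..i + int n}. y j = x j" by simp_all
  then have "factor x i n = factor y i n" by (auto simp: factor_eq_iff)
  with y show ?thesis by (metis factor_in_factors)
qed

lemma linear_complexity_shiftI:
  assumes "finite A" "is_shift A X"
    and "limsup (\<lambda>n. ereal (real (complexity A X n) / real n)) < ereal (real k)"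
    and "shift_topology A X closure_of {x \<in> X. \<not> periodic x} = X"
  shows "linear_complexity_shift A X k"
proof (unfold_locales; (intro assms(1))?)
  show "\<forall>\<^sub>F n in sequentially. card (\<Union>x\<in>X. factors x n) + C < k * n" for C
    using limsup_linear_growth[OF assms(3)] by (simp add: complexity_factors[OF assms(2)])
qed (use assms is_shift_in_alphabet is_shift_shift_power is_shift_subseq_limit dense_aperiodic_factor in blast)+

subsection \<open>Automorphisms as block maps\<close>

lemma Aut_carrier: "\<phi> \<in> Aut A X \<Longrightarrow> \<phi> \<in> carrier (homeo_group (shift_topology A X))"
  by (simp add: Aut_def)

lemma Aut_closed:
  assumes "is_shift A X" "\<phi> \<in> Aut A X" "x \<in> X" shows "\<phi> x \<in> X"
  using homeo_group_apply_mem[OF Aut_carrier[OF assms(2)], of x] assms(3)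
  by (simp add: topspace_shift_topology[OF assms(1)])

lemma Aut_shift_power:
  assumes "is_shift A X" "\<phi> \<in> Aut A X" "x \<in> X"
  shows "\<phi> (shift_power s x) = shift_power s (\<phi> x)"
proof -
  have pos: "\<phi> (shift_power (int n) y) = shift_power (int n) (\<phi> y)" if "y \<in> X" for n y
    using Aut_funpow[OF assms(1,2) that, of n] by (simp add: shift_power_def)
  show ?thesis
  proof (cases "s \<ge> 0")
    case True
    then show ?thesis using pos[OF assms(3), of "nat s"] by simp
  next
    case False
    let ?y = "shift_power s x"
    have "shift_power (- s) ?y = x" by (simp add: fun_eq_iff shift_power_apply)
    then have "\<phi> x = shift_power (- s) (\<phi> ?y)"
      using pos[OF is_shift_shift_power[OF assms(1,3), of s], of "nat (- s)"] False by simp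
    then show ?thesis by (simp add: fun_eq_iff shift_power_apply)
  qed
qed

lemma Aut_inv:
  assumes X: "is_shift A X" and \<phi>: "\<phi> \<in> Aut A X"
  shows "inv\<^bsub>Aut_group A X\<^esub> \<phi> \<in> Aut A X"
    and "x \<in> X \<Longrightarrow> (inv\<^bsub>Aut_group A X\<^esub> \<phi>) (\<phi> x) = x"
    and "x \<in> X \<Longrightarrow> \<phi> ((inv\<^bsub>Aut_group A X\<^esub> \<phi>) x) = x"
proof -
  have eq: "inv\<^bsub>Aut_group A X\<^esub> \<phi> = inv\<^bsub>homeo_group (shift_topology A X)\<^esub> \<phi>"
    unfolding Aut_group_def
    using group.m_inv_consistent[OF group_homeo_group subgroup_Aut[OF X] \<phi>] by simp
  show "inv\<^bsub>Aut_group A X\<^esub> \<phi> \<in> Aut A X"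
    unfolding eq by (rule subgroup.m_inv_closed[OF subgroup_Aut[OF X] \<phi>])
  show "(inv\<^bsub>Aut_group A X\<^esub> \<phi>) (\<phi> x) = x" "\<phi> ((inv\<^bsub>Aut_group A X\<^esub> \<phi>) x) = x" if "x \<in> X"
    unfolding eq using homeo_group_inv[OF Aut_carrier[OF \<phi>]] that topspace_shift_topology[OF X] by auto
qed

lemma Aut_mult:
  assumes "is_shift A X" "\<phi> \<in> Aut A X" "\<psi> \<in> Aut A X" "x \<in> X"
  shows "(\<phi> \<otimes>\<^bsub>Aut_group A X\<^esub> \<psi>) x = \<phi> (\<psi> x)"
  using homeo_group_simps(3)[OF Aut_carrier[OF assms(2)] Aut_carrier[OF assms(3)]] assms(4)
    topspace_shift_topology[OF assms(1)]
  by (simp add: Aut_group_def compose_def)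

lemma Aut_full_groupI:
  assumes "\<phi> \<in> Aut A X" "\<And>x. x \<in> X \<Longrightarrow> \<phi> x \<in> shift_orbit x"
  shows "\<phi> \<in> Aut A X \<inter> full_group A X"
  using assms by (auto simp: full_group_def Aut_def)

section \<open>Block codes, finite index and the lattice for \<open>Aut A X\<close>\<close>

context linear_complexity_shift
begin

text \<open>The Curtis-Hedlund-Lyndon theorem: if no radius determined the value at 0, pairs
  agreeing on ever larger windows but with different values there would accumulate at one point y,
  against continuity at y.\<close>

lemma Aut_block_map:
  assumes X: "is_shift A X" and \<phi>: "\<phi> \<in> Aut A X"
  shows "block_map \<phi>"
proof -
  have "\<exists>N::nat. \<forall>x\<in>X. \<forall>y\<in>X. (\<forall>i. \<bar>i\<bar> \<le> int N \<longrightarrow> x i = y i) \<longrightarrow> \<phi> x 0 = \<phi> y 0"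
  proof (rule ccontr)
    assume "\<not> ?thesis"
    then obtain f g where fg: "\<And>N::nat. f N \<in> X" "\<And>N. g N \<in> X"
      "\<And>N i. \<bar>i\<bar> \<le> int N \<Longrightarrow> f N i = g N i" "\<And>N. \<phi> (f N) 0 \<noteq> \<phi> (g N) 0" by metis
    obtain y r where y: "y \<in> X" "strict_mono r" "\<And>n i. \<bar>i\<bar> \<le> int n \<Longrightarrow> f (r n) i = y i"
      using subseq_limit[of f] fg(1) by blast
    let ?U = "{z. (\<forall>i. z i \<in> A) \<and> (\<forall>i\<in>{0}. z i = \<phi> y i)}"
    have top: "topspace (shift_topology A X) = X" by (rule topspace_shift_topology[OF X])
    have "continuous_map (shift_topology A X) (shift_topology A X) \<phi>"
      using Aut_carrier[OF \<phi>] by (auto simp: homeo_group_simps intro: homeomorphic_imp_continuous_map)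
    moreover have "openin (shift_topology A X) (?U \<inter> X)"
      unfolding shift_topology_def openin_subtopology using openin_cylinder[of "{0}" A "\<phi> y"] by blast
    ultimately have "openin (shift_topology A X) {x \<in> topspace (shift_topology A X). \<phi> x \<in> ?U \<inter> X}"
      by (rule openin_continuous_map_preimage)
    then have "openin (shift_topology A X) {x \<in> X. \<phi> x \<in> ?U \<inter> X}" by (simp only: top)
    then obtain V where V: "openin (full_shift A) V" "{x \<in> X. \<phi> x \<in> ?U \<inter> X} = V \<inter> X"
      unfolding shift_topology_def openin_subtopology by blast
    have "y \<in> {x \<in> X. \<phi> x \<in> ?U \<inter> X}"
      using y(1) Aut_closed[OF X \<phi>] in_alphabet by simp
    then have "y \<in> V" using V(2) by blast
    then obtain N where N: "\<And>z. (\<And>i. z i \<in> A) \<Longrightarrow> (\<And>i. \<bar>i\<bar> \<le> int N \<Longrightarrow> z i = y i) \<Longrightarrow> z \<in> V"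
      using open_contains_cylinder[OF V(1)] by metis
    have val: "\<phi> z 0 = \<phi> y 0" if "z \<in> X" "\<And>i. \<bar>i\<bar> \<le> int N \<Longrightarrow> z i = y i" for z
    proof -
      have "z \<in> V" using that in_alphabet by (intro N) auto
      then have "z \<in> {x \<in> X. \<phi> x \<in> ?U \<inter> X}" using that(1) V(2) by blast
      then show ?thesis by simp
    qed
    have "\<phi> (f (r N)) 0 = \<phi> y 0" by (rule val[OF fg(1) y(3)])
    moreover have "\<phi> (g (r N)) 0 = \<phi> y 0"
    proof (rule val[OF fg(2)])
      fix i assume i: "\<bar>i\<bar> \<le> int N"
      then have "\<bar>i\<bar> \<le> int (r N)" using seq_suble[OF y(2), of N] by simp
      then show "g (r N) i = y i" using fg(3) y(3)[OF i] by metis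
    qed
    ultimately show False using fg(4)[of "r N"] by simp
  qed
  then obtain N :: nat where N: "\<And>x y. x \<in> X \<Longrightarrow> y \<in> X \<Longrightarrow> (\<And>i. \<bar>i\<bar> \<le> int N \<Longrightarrow> x i = y i) \<Longrightarrow> \<phi> x 0 = \<phi> y 0"
    by blast
  have "\<phi> x i = \<phi> y j" if xy: "x \<in> X" "y \<in> X"
    and eq: "factor x (i - int N) (2 * N + 1) = factor y (j - int N) (2 * N + 1)" for x y i j
  proof -
    \<comment> \<open>Commutation with the shift carries the radius found at 0 to all
      positions.\<close>
    have "\<phi> (shift_power i x) 0 = \<phi> (shift_power j y) 0"
    proof (rule N)
      fix m assume m: "\<bar>m\<bar> \<le> int N"
      then have "0 \<le> m + int N \<and> m + int N < int (2 * N + 1)" by auto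
      then have "x (i - int N + (m + int N)) = y (j - int N + (m + int N))"
        using eq unfolding factor_eq_iff by blast
      then show "shift_power i x m = shift_power j y m" by (simp add: shift_power_apply algebra_simps)
    qed (use xy shift_closed in auto)
    then show ?thesis using xy by (simp add: Aut_shift_power[OF X \<phi>] shift_power_apply)
  qed
  then show ?thesis unfolding block_map_def using Aut_closed[OF X \<phi>] by blast
qed

lemma Aut_auto_map:
  assumes "is_shift A X" "\<phi> \<in> Aut A X"
  shows "auto_map \<phi>"
  unfolding auto_map_def using Aut_block_map Aut_inv assms by blast

lemma finite_cosets:
  assumes X: "is_shift A X"
  shows "finite (rcosets\<^bsub>Aut_group A X\<^esub> (Aut A X \<inter> full_group A X))"
proof -
  let ?G = "Aut_group A X" and ?N = "Aut A X \<inter> full_group A X"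
  interpret group ?G by (rule group_Aut_group[OF X])
  have carr: "carrier ?G = Aut A X" by (simp add: Aut_group_def)
  have sub: "subgroup ?N ?G" using normal_Aut_Int_full_group[OF X] by (rule normal_imp_subgroup)
  obtain Y where Y: "finite Y" "Y \<subseteq> X" "\<And>x. x \<in> X \<Longrightarrow> \<exists>y\<in>Y. x \<preceq> y"
    "\<And>y. y \<in> Y \<Longrightarrow> finite ((\<lambda>\<phi>. shift_orbit (\<phi> y)) ` Collect auto_map)"
    by (rule finite_auto_classes) blast
  \<comment> \<open>Only the orbits of the images are recorded. The shift between two images may
    depend on y, so equal values of c place the quotient of two automorphisms in the full group
    without making it a power of the shift.\<close>
  define c where "c \<phi> = (\<lambda>y\<in>Y. shift_orbit (\<phi> y))" for \<phi> :: "(int \<Rightarrow> 'a) \<Rightarrow> int \<Rightarrow> 'a"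
  have "finite (c ` Aut A X)"
  proof (rule finite_subset)
    show "c ` Aut A X \<subseteq> (\<Pi>\<^sub>E y\<in>Y. (\<lambda>\<phi>. shift_orbit (\<phi> y)) ` Collect auto_map)"
      using Aut_auto_map[OF X] by (auto simp: c_def)
    show "finite (\<Pi>\<^sub>E y\<in>Y. (\<lambda>\<phi>. shift_orbit (\<phi> y)) ` Collect auto_map)"
      using Y(1,4) by (rule finite_PiE)
  qed
  then have "finite ((\<lambda>\<phi>. ?N #>\<^bsub>?G\<^esub> \<phi>) ` Aut A X)"
  proof (rule finite_image_factor)
    fix \<phi> \<psi> assume \<phi>: "\<phi> \<in> Aut A X" and \<psi>: "\<psi> \<in> Aut A X" and eq: "c \<phi> = c \<psi>"
    let ?\<theta> = "\<psi> \<otimes>\<^bsub>?G\<^esub> inv\<^bsub>?G\<^esub> \<phi>"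
    have \<theta>: "?\<theta> \<in> Aut A X" using \<phi> \<psi> by (metis carr inv_closed m_closed)
    have "?\<theta> \<in> ?N"
    proof (rule Aut_full_groupI[OF \<theta>])
      fix x assume x: "x \<in> X"
      define w where "w = (inv\<^bsub>?G\<^esub> \<phi>) x"
      have w: "w \<in> X" "\<phi> w = x"
        using Aut_closed[OF X Aut_inv(1)[OF X \<phi>] x] Aut_inv(3)[OF X \<phi> x] by (simp_all add: w_def)
      obtain y where y: "y \<in> Y" "w \<preceq> y" using Y(3)[OF w(1)] by blast
      have yX: "y \<in> X" using y Y(2) by blast
      have "shift_orbit (\<phi> y) = shift_orbit (\<psi> y)"
        using fun_cong[OF eq, of y] y(1) by (simp add: c_def)
      then have "\<psi> y \<in> shift_orbit (\<phi> y)" using shift_orbit_refl by blast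
      then obtain d where "\<psi> y = shift_power d (\<phi> y)" by (auto simp: shift_orbit_def)
      from block_map_eq_shift[OF Aut_block_map[OF X \<psi>] Aut_block_map[OF X \<phi>] yX w(1) y(2) this]
      have "\<psi> w = shift_power d x" using w(2) by simp
      then have "?\<theta> x = shift_power d x"
        using Aut_mult[OF X \<psi> Aut_inv(1)[OF X \<phi>] x] by (simp add: w_def)
      then show "?\<theta> x \<in> shift_orbit x" by (simp add: shift_orbit_def)
    qed
    then have "?\<theta> \<otimes>\<^bsub>?G\<^esub> \<phi> \<in> ?N #>\<^bsub>?G\<^esub> \<phi>"
      using \<phi> by (intro rcosI) (auto simp: carr)
    moreover have "\<phi> \<in> carrier ?G" "\<psi> \<in> carrier ?G" using \<phi> \<psi> by (simp_all add: carr)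
    then have "?\<theta> \<otimes>\<^bsub>?G\<^esub> \<phi> = \<psi>" by (simp add: m_assoc)
    ultimately show "?N #>\<^bsub>?G\<^esub> \<phi> = ?N #>\<^bsub>?G\<^esub> \<psi>"
      using \<phi> sub by (intro repr_independence) (auto simp: carr)
  qed
  moreover have "rcosets\<^bsub>?G\<^esub> ?N = (\<lambda>\<phi>. ?N #>\<^bsub>?G\<^esub> \<phi>) ` Aut A X"
    by (auto simp: RCOSETS_def carr)
  ultimately show ?thesis by simp
qed

lemma Aut_full_group_lattice:
  assumes X: "is_shift A X"
  shows "\<exists>d<k. (Aut_group A X)\<lparr>carrier := Aut A X \<inter> full_group A X\<rparr> \<cong> integer_lattice_group d"
proof -
  let ?G = "Aut_group A X" and ?N = "Aut A X \<inter> full_group A X"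
  let ?GN = "?G\<lparr>carrier := ?N\<rparr>"
  interpret group ?G by (rule group_Aut_group[OF X])
  have sub: "subgroup ?N ?G" using normal_Aut_Int_full_group[OF X] by (rule normal_imp_subgroup)
  obtain xs where xs: "set xs \<subseteq> {x \<in> X. \<not> periodic x}" "length xs < k"
    and cover: "\<And>y. y \<in> X \<Longrightarrow> \<exists>x\<in>set xs. y \<preceq> x"
    by (rule aperiodic_cover) blast
  have xsX: "xs ! i \<in> X" and xsap: "\<not> periodic (xs ! i)" if "i < length xs" for i
    using xs(1) nth_mem[OF that] by auto
  \<comment> \<open>The shift amount is unique because the listed points are aperiodic; it is
    additive because automorphisms commute with the shift.\<close>
  define f where "f i \<phi> = (THE n. \<phi> (xs ! i) = shift_power n (xs ! i))"
    for i and \<phi> :: "(int \<Rightarrow> 'a) \<Rightarrow> int \<Rightarrow> 'a"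
  have f_eq: "f i \<phi> = n" if "i < length xs" "\<phi> (xs ! i) = shift_power n (xs ! i)" for i \<phi> n
    unfolding f_def
  proof (rule the_equality)
    show "m = n" if "\<phi> (xs ! i) = shift_power m (xs ! i)" for m
      using that \<open>\<phi> (xs ! i) = shift_power n (xs ! i)\<close> shift_power_eq_periodic xsap[OF \<open>i < length xs\<close>] by metis
  qed (rule that(2))
  have f: "\<phi> (xs ! i) = shift_power (f i \<phi>) (xs ! i)" if "i < length xs" "\<phi> \<in> ?N" for i \<phi>
  proof -
    have "\<phi> (xs ! i) \<in> shift_orbit (xs ! i)" using that xsX by (auto simp: full_group_def)
    then show ?thesis using f_eq[OF that(1)] by (auto simp: shift_orbit_def)
  qed
  have "\<exists>d\<le>length xs. ?GN \<cong> integer_lattice_group d"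
  proof (rule embedded_in_lattice)
    show "group ?GN" using sub by (rule subgroup_imp_group)
  next
    fix i assume i: "i < length xs"
    show "f i \<in> hom ?GN integer_group"
    proof (rule homI)
      fix \<phi> \<psi> assume "\<phi> \<in> carrier ?GN" "\<psi> \<in> carrier ?GN"
      then have N: "\<phi> \<in> ?N" "\<psi> \<in> ?N" by simp_all
      then have AutN: "\<phi> \<in> Aut A X" "\<psi> \<in> Aut A X" by auto
      have "(\<phi> \<otimes>\<^bsub>?G\<^esub> \<psi>) (xs ! i) = \<phi> (shift_power (f i \<psi>) (xs ! i))"
        using Aut_mult[OF X AutN xsX[OF i]] f[OF i N(2)] by simp
      also have "\<dots> = shift_power (f i \<psi>) (shift_power (f i \<phi>) (xs ! i))"
        using Aut_shift_power[OF X AutN(1) xsX[OF i]] f[OF i N(1)] by simp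
      also have "\<dots> = shift_power (f i \<phi> + f i \<psi>) (xs ! i)"
        by (simp add: fun_eq_iff shift_power_apply algebra_simps)
      finally show "f i (\<phi> \<otimes>\<^bsub>?GN\<^esub> \<psi>) = f i \<phi> \<otimes>\<^bsub>integer_group\<^esub> f i \<psi>"
        using f_eq[OF i] by simp
    qed simp
  next
    fix \<phi> assume "\<phi> \<in> carrier ?GN" and zero: "\<And>i. i < length xs \<Longrightarrow> f i \<phi> = 0"
    then have N: "\<phi> \<in> ?N" "\<phi> \<in> Aut A X" by simp_all
    \<comment> \<open>Comparing \<phi> with the identity at shift amount 0 turns fixing the listed
      points into fixing their orbit closures, which cover X.\<close>
    have id_block: "block_map (\<lambda>x. x)"
      unfolding block_map_def by (auto intro!: exI[of _ 0] simp: factor_def)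
    have fix_all: "\<phi> y = y" if y: "y \<in> X" for y
    proof -
      obtain i where i: "i < length xs" "y \<preceq> xs ! i" using cover[OF y] by (metis in_set_conv_nth)
      have "\<phi> (xs ! i) = shift_power 0 (xs ! i)" using f[OF i(1) N(1)] zero[OF i(1)] by simp
      from block_map_eq_shift[OF Aut_block_map[OF X N(2)] id_block xsX[OF i(1)] y i(2) this]
      show ?thesis by (simp add: fun_eq_iff shift_power_apply)
    qed
    \<comment> \<open>The unit of the group is the identity restricted to X, so the values outside X
      must match as well.\<close>
    have "\<phi> \<in> extensional X"
      using Aut_carrier[OF N(2)] topspace_shift_topology[OF X] by (auto simp: homeo_group_simps Bij_def)
    then have "\<phi> = (\<lambda>x\<in>X. x)" using fix_all by (auto simp: fun_eq_iff extensional_def)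
    then show "\<phi> = \<one>\<^bsub>?GN\<^esub>"
      by (simp add: Aut_group_def homeo_group_simps topspace_shift_topology[OF X])
  qed
  then show ?thesis using xs(2) le_less_trans by blast
qed

end

theorem theorem1p2:
  fixes A :: "'a set" and X :: "(int \<Rightarrow> 'a) set" and k :: nat
  assumes "finite A"
    and "is_shift A X"
    and "limsup (\<lambda>n. ereal (real (complexity A X n) / real n)) < ereal (real k)"
    and "shift_topology A X closure_of {x \<in> X. \<not> periodic x} = X"
  shows "\<exists>d<k.
      (Aut_group A X)\<lparr>carrier := Aut A X \<inter> full_group A X\<rparr> \<cong> integer_lattice_group d \<and>
      finite (carrier (Aut_group A X Mod (Aut A X \<inter> full_group A X))) \<and>
      virtually (Aut_group A X) (integer_lattice_group d)"
proof -
  interpret linear_complexity_shift A X k using assms by (rule linear_complexity_shiftI)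
  obtain d where d: "d < k"
    "(Aut_group A X)\<lparr>carrier := Aut A X \<inter> full_group A X\<rparr> \<cong> integer_lattice_group d"
    using Aut_full_group_lattice[OF assms(2)] by blast
  have fin: "finite (rcosets\<^bsub>Aut_group A X\<^esub> (Aut A X \<inter> full_group A X))"
    by (rule finite_cosets[OF assms(2)])
  moreover have "subgroup (Aut A X \<inter> full_group A X) (Aut_group A X)"
    using normal_Aut_Int_full_group[OF assms(2)] by (rule normal_imp_subgroup)
  \<comment> \<open>The normal subgroup itself is the finite-index copy of the lattice.\<close>
  ultimately have "virtually (Aut_group A X) (integer_lattice_group d)"
    using d(2) unfolding virtually_def by blast
  with d fin show ?thesis by (auto simp: FactGroup_def)
qed

end
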